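(* Consider the variety of $3\times2\times2$ tensors with entries $$f_{ijk}=(-1)^{i+j+k}\cdot\det\begin{bmatrix}A_l^T&A_m^T&B_{\hat j}^T&C_{\hat k}^T\end{bmatrix},\qquad i\in\{1,2,3\},\ j,k\in\{1,2\},$$ associated with a pinhole camera $A$ (a $3\times4$-matrix) and a two-slit camera $(B,C)$ (a pair of $2\times4$-matrices). This variety is the unique $\mathrm{SL}(3)\times\mathrm{SL}(2)\times\mathrm{SL}(2)$-invariant hypersurface of degree $6$ in $\mathbb{P}^{11}=\mathbb{P}(\mathbb{C}^3\otimes\mathbb{C}^2\otimes\mathbb{C}^2)$. Its defining polynomial is $$\begin{aligned} &f_{111}^2f_{212}f_{221}f_{322}^2-f_{111}^2f_{212}f_{222}f_{321}f_{322}-f_{111}^2f_{221}f_{222}f_{312}f_{322}+f_{111}^2f_{222}^2f_{312}f_{321}\\ &-f_{111}f_{112}f_{211}f_{221}f_{322}^2+f_{111}f_{112}f_{211}f_{222}f_{321}f_{322}-f_{111}f_{112}f_{212}f_{221}f_{321}f_{322}+f_{111}f_{112}f_{212}f_{222}f_{321}^2\\ &+f_{111}f_{112}f_{221}^2f_{312}f_{322}+f_{111}f_{112}f_{221}f_{222}f_{311}f_{322}-f_{111}f_{112}f_{221}f_{222}f_{312}f_{321}-f_{111}f_{112}f_{222}^2f_{311}f_{321}\\ &-f_{111}f_{121}f_{211}f_{212}f_{322}^2+f_{111}f_{121}f_{211}f_{222}f_{312}f_{322}+f_{111}f_{121}f_{212}^2f_{321}f_{322}-f_{111}f_{121}f_{212}f_{221}f_{312}f_{322}\\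 &+f_{111}f_{121}f_{212}f_{222}f_{311}f_{322}-f_{111}f_{121}f_{212}f_{222}f_{312}f_{321}+f_{111}f_{121}f_{221}f_{222}f_{312}^2-f_{111}f_{121}f_{222}^2f_{311}f_{312}\\ &+f_{111}f_{122}f_{211}f_{212}f_{321}f_{322}+f_{111}f_{122}f_{211}f_{221}f_{312}f_{322}-2f_{111}f_{122}f_{211}f_{222}f_{312}f_{321}-f_{111}f_{122}f_{212}^2f_{321}^2\\ &-2f_{111}f_{122}f_{212}f_{221}f_{311}f_{322}+2f_{111}f_{122}f_{212}f_{221}f_{312}f_{321}+f_{111}f_{122}f_{212}f_{222}f_{311}f_{321}-f_{111}f_{122}f_{221}^2f_{312}^2\\ &+f_{111}f_{122}f_{221}f_{222}f_{311}f_{312}+f_{112}^2f_{211}f_{221}f_{321}f_{322}-f_{112}^2f_{211}f_{222}f_{321}^2-f_{112}^2f_{221}^2f_{311}f_{322}\\ &+f_{112}^2f_{221}f_{222}f_{311}f_{321}+f_{112}f_{121}f_{211}^2f_{322}^2-f_{112}f_{121}f_{211}f_{212}f_{321}f_{322}-f_{112}f_{121}f_{211}f_{221}f_{312}f_{322}\\ &+f_{112}f_{121}f_{222}^2f_{311}^2+2f_{112}f_{121}f_{211}f_{222}f_{312}f_{321}+2f_{112}f_{121}f_{212}f_{221}f_{311}f_{322}-f_{112}f_{121}f_{212}f_{222}f_{311}f_{321}\\ &-2f_{112}f_{121}f_{211}f_{222}f_{311}f_{322}-f_{112}f_{121}f_{221}f_{222}f_{311}f_{312}-f_{112}f_{122}f_{211}^2f_{321}f_{322}+f_{112}f_{122}f_{211}f_{221}f_{311}f_{322}\\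 &+f_{112}f_{122}f_{211}f_{212}f_{321}^2-f_{112}f_{122}f_{211}f_{221}f_{312}f_{321}+f_{112}f_{122}f_{211}f_{222}f_{311}f_{321}-f_{112}f_{122}f_{212}f_{221}f_{311}f_{321}\\ &+f_{112}f_{122}f_{221}^2f_{311}f_{312}-f_{112}f_{122}f_{221}f_{222}f_{311}^2+f_{121}^2f_{211}f_{212}f_{312}f_{322}-f_{121}^2f_{211}f_{222}f_{312}^2-f_{121}^2f_{212}^2f_{311}f_{322}\\ &+f_{121}^2f_{212}f_{222}f_{311}f_{312}-f_{121}f_{122}f_{211}^2f_{312}f_{322}+f_{121}f_{122}f_{211}f_{212}f_{311}f_{322}-f_{121}f_{122}f_{211}f_{212}f_{312}f_{321}\\ &+f_{121}f_{122}f_{211}f_{221}f_{312}^2+f_{121}f_{122}f_{211}f_{222}f_{311}f_{312}+f_{121}f_{122}f_{212}^2f_{311}f_{321}-f_{121}f_{122}f_{212}f_{221}f_{311}f_{312}\\ &-f_{121}f_{122}f_{212}f_{222}f_{311}^2+f_{122}^2f_{211}^2f_{312}f_{321}-f_{122}^2f_{211}f_{212}f_{311}f_{321}-f_{122}^2f_{211}f_{221}f_{311}f_{312}+f_{122}^2f_{212}f_{221}f_{311}^2. \end{aligned}$$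
   Context: Work over $\mathbb{C}$. $A_1,A_2,A_3$ are the rows of the $3\times4$-matrix $A$; $B_1,B_2$ and $C_1,C_2$ are the rows of the $2\times4$-matrices $B$ and $C$. In the formula for $f_{ijk}$, $\{i,l,m\}=\{1,2,3\}$ with $l<m$, and $\hat j$, $\hat k$ denote the elements of $\{1,2\}$ different from $j$, $k$ respectively. The "variety of tensors" is the Zariski closure in $\mathbb{P}^{11}$ of the set of all tensors $(f_{ijk})$ of this form, as $A,B,C$ vary. (A pinhole camera is the linear map $\mathbb{P}^3\dashrightarrow\mathbb{P}^2$, $x\mapsto Ax$; a linear two-slit camera is the map $\mathbb{P}^3\dashrightarrow\mathbb{P}^1\times\mathbb{P}^1$, $x\mapsto(Bx,Cx)$, where the kernels of $B$ and $C$ are two skew lines.) The group $\mathrm{SL}(3)\times\mathrm{SL}(2)\times\mathrm{SL}(2)$ acts naturally on the three tensor factors. *)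

theory Defs
  imports "HOL-Analysis.Analysis" "HOL-Library.Poly_Mapping"
begin

section \<open>Complex projective space\<close>

text \<open>
  The polynomial ring over the complex numbers in the variables indexed by \<open>'i\<close>
  is the ring of finitely supported maps from exponent vectors to coefficients.
\<close>

type_synonym 'i cpoly = "('i \<Rightarrow>\<^sub>0 nat) \<Rightarrow>\<^sub>0 complex"

definition var :: "'i \<Rightarrow> 'i cpoly" where
  "var i = Poly_Mapping.single (Poly_Mapping.single i 1) 1"

definition eval_poly :: "'i::finite cpoly \<Rightarrow> complex ^ 'i \<Rightarrow> complex" where
  "eval_poly F x =
     (\<Sum>m\<in>Poly_Mapping.keys F.
        Poly_Mapping.lookup F m * (\<Prod>i\<in>UNIV. (x $ i) ^ Poly_Mapping.lookup m i))"

definition homogeneous :: "nat \<Rightarrow> 'i::finite cpoly \<Rightarrow> bool" where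
  "homogeneous d F \<longleftrightarrow>
     (\<forall>m\<in>Poly_Mapping.keys F. (\<Sum>i\<in>UNIV. Poly_Mapping.lookup m i) = d)"

text \<open>A point of projective space is a line through the origin, as a set of vectors.\<close>

definition proj_space :: "(complex ^ 'i::finite) set set" where
  "proj_space = {L. vec.subspace L \<and> vec.dim L = 1}"

definition zero_locus :: "'i::finite cpoly set \<Rightarrow> (complex ^ 'i) set set" where
  "zero_locus S = {L \<in> proj_space. \<forall>F\<in>S. \<forall>x\<in>L. eval_poly F x = 0}"

definition zariski_closed :: "(complex ^ 'i::finite) set set \<Rightarrow> bool" where
  "zariski_closed Z \<longleftrightarrow> (\<exists>S. (\<forall>F\<in>S. \<exists>d. homogeneous d F) \<and> Z = zero_locus S)"

definition vanishing_ideal :: "(complex ^ 'i::finite) set set \<Rightarrow> 'i cpoly set" where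
  "vanishing_ideal Y = {F. \<forall>L\<in>Y. \<forall>x\<in>L. eval_poly F x = 0}"

text \<open>
  The form \<open>F\<close> below may have repeated factors. Hence a uniqueness claim about
  \<open>hypersurface d\<close> also covers non-reduced equations, while the degree of a
  hypersurface as a variety is the \<open>d\<close> for which it has a \<open>defining_form\<close>.
\<close>

definition hypersurface :: "nat \<Rightarrow> (complex ^ 'i::finite) set set \<Rightarrow> bool" where
  "hypersurface d Y \<longleftrightarrow> (\<exists>F. F \<noteq> 0 \<and> homogeneous d F \<and> Y = zero_locus {F})"

definition defining_form :: "nat \<Rightarrow> 'i::finite cpoly \<Rightarrow> (complex ^ 'i) set set \<Rightarrow> bool" where
  "defining_form d F Y \<longleftrightarrow>
     F \<noteq> 0 \<and> homogeneous d F \<and> Y = zero_locus {F} \<and> vanishing_ideal Y = {G. F dvd G}"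


section \<open>Tensors of format 3 x 2 x 2\<close>

text \<open>
  Coordinates with respect to the standard basis of the tensor product. The elements of
  the index types are written \<open>1, 2, 3\<close> and \<open>1, 2\<close>; as these types have
  modular arithmetic (\<open>3 = 0\<close> and \<open>2 = 0\<close>), signs and complementary
  indices are given by case distinction.
\<close>

type_synonym tensor_index = "3 \<times> 2 \<times> 2"
type_synonym tensor322 = "complex ^ tensor_index"

definition sl_act ::
    "complex^3^3 \<Rightarrow> complex^2^2 \<Rightarrow> complex^2^2 \<Rightarrow> tensor322 \<Rightarrow> tensor322" where
  "sl_act g h k t =
     (\<chi> p. case p of (a, b, c) \<Rightarrow>
        \<Sum>i\<in>UNIV. \<Sum>j\<in>UNIV. \<Sum>l\<in>UNIV. g $ a $ i * h $ b $ j * k $ c $ l * t $ (i, j, l))"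

definition SL_invariant :: "tensor322 set set \<Rightarrow> bool" where
  "SL_invariant Y \<longleftrightarrow>
     (\<forall>g h k. det g = 1 \<and> det h = 1 \<and> det k = 1 \<longrightarrow> (\<lambda>L. sl_act g h k ` L) ` Y = Y)"

definition num3 :: "3 \<Rightarrow> nat" where
  "num3 i = (if i = 1 then 1 else if i = 2 then 2 else 3)"

definition num2 :: "2 \<Rightarrow> nat" where
  "num2 j = (if j = 1 then 1 else 2)"

definition other2 :: "2 \<Rightarrow> 2" where
  "other2 j = (if j = 1 then 2 else 1)"

text \<open>The two indices different from \<open>i\<close>, in increasing order.\<close>

definition others3 :: "3 \<Rightarrow> 3 \<times> 3" where
  "others3 i = (if i = 1 then (2, 3) else if i = 2 then (1, 3) else (1, 2))"

definition camera_tensor :: "complex^4^3 \<Rightarrow> complex^4^2 \<Rightarrow> complex^4^2 \<Rightarrow> tensor322" where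
  "camera_tensor A B C =
     (\<chi> p. case p of (i, j, k) \<Rightarrow> case others3 i of (l, m) \<Rightarrow>
        (-1) ^ (num3 i + num2 j + num2 k) *
        det (transpose (vector [row l A, row m A, row (other2 j) B, row (other2 k) C] :: complex^4^4)))"

definition camera_variety :: "tensor322 set set" where
  "camera_variety =
     zariski_closed hull {vec.span {camera_tensor A B C} | A B C. camera_tensor A B C \<noteq> 0}"

definition camera_poly :: "tensor_index cpoly" where
  "camera_poly =
     (let f = (\<lambda>i j k. var (i, j, k)) in
        (f 1 1 1)^2 * f 2 1 2 * f 2 2 1 * (f 3 2 2)^2
      - (f 1 1 1)^2 * f 2 1 2 * f 2 2 2 * f 3 2 1 * f 3 2 2
      - (f 1 1 1)^2 * f 2 2 1 * f 2 2 2 * f 3 1 2 * f 3 2 2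
      + (f 1 1 1)^2 * (f 2 2 2)^2 * f 3 1 2 * f 3 2 1
      - f 1 1 1 * f 1 1 2 * f 2 1 1 * f 2 2 1 * (f 3 2 2)^2
      + f 1 1 1 * f 1 1 2 * f 2 1 1 * f 2 2 2 * f 3 2 1 * f 3 2 2
      - f 1 1 1 * f 1 1 2 * f 2 1 2 * f 2 2 1 * f 3 2 1 * f 3 2 2
      + f 1 1 1 * f 1 1 2 * f 2 1 2 * f 2 2 2 * (f 3 2 1)^2
      + f 1 1 1 * f 1 1 2 * (f 2 2 1)^2 * f 3 1 2 * f 3 2 2
      + f 1 1 1 * f 1 1 2 * f 2 2 1 * f 2 2 2 * f 3 1 1 * f 3 2 2
      - f 1 1 1 * f 1 1 2 * f 2 2 1 * f 2 2 2 * f 3 1 2 * f 3 2 1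
      - f 1 1 1 * f 1 1 2 * (f 2 2 2)^2 * f 3 1 1 * f 3 2 1
      - f 1 1 1 * f 1 2 1 * f 2 1 1 * f 2 1 2 * (f 3 2 2)^2
      + f 1 1 1 * f 1 2 1 * f 2 1 1 * f 2 2 2 * f 3 1 2 * f 3 2 2
      + f 1 1 1 * f 1 2 1 * (f 2 1 2)^2 * f 3 2 1 * f 3 2 2
      - f 1 1 1 * f 1 2 1 * f 2 1 2 * f 2 2 1 * f 3 1 2 * f 3 2 2
      + f 1 1 1 * f 1 2 1 * f 2 1 2 * f 2 2 2 * f 3 1 1 * f 3 2 2
      - f 1 1 1 * f 1 2 1 * f 2 1 2 * f 2 2 2 * f 3 1 2 * f 3 2 1
      + f 1 1 1 * f 1 2 1 * f 2 2 1 * f 2 2 2 * (f 3 1 2)^2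
      - f 1 1 1 * f 1 2 1 * (f 2 2 2)^2 * f 3 1 1 * f 3 1 2
      + f 1 1 1 * f 1 2 2 * f 2 1 1 * f 2 1 2 * f 3 2 1 * f 3 2 2
      + f 1 1 1 * f 1 2 2 * f 2 1 1 * f 2 2 1 * f 3 1 2 * f 3 2 2
      - 2 * f 1 1 1 * f 1 2 2 * f 2 1 1 * f 2 2 2 * f 3 1 2 * f 3 2 1
      - f 1 1 1 * f 1 2 2 * (f 2 1 2)^2 * (f 3 2 1)^2
      - 2 * f 1 1 1 * f 1 2 2 * f 2 1 2 * f 2 2 1 * f 3 1 1 * f 3 2 2
      + 2 * f 1 1 1 * f 1 2 2 * f 2 1 2 * f 2 2 1 * f 3 1 2 * f 3 2 1
      + f 1 1 1 * f 1 2 2 * f 2 1 2 * f 2 2 2 * f 3 1 1 * f 3 2 1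
      - f 1 1 1 * f 1 2 2 * (f 2 2 1)^2 * (f 3 1 2)^2
      + f 1 1 1 * f 1 2 2 * f 2 2 1 * f 2 2 2 * f 3 1 1 * f 3 1 2
      + (f 1 1 2)^2 * f 2 1 1 * f 2 2 1 * f 3 2 1 * f 3 2 2
      - (f 1 1 2)^2 * f 2 1 1 * f 2 2 2 * (f 3 2 1)^2
      - (f 1 1 2)^2 * (f 2 2 1)^2 * f 3 1 1 * f 3 2 2
      + (f 1 1 2)^2 * f 2 2 1 * f 2 2 2 * f 3 1 1 * f 3 2 1
      + f 1 1 2 * f 1 2 1 * (f 2 1 1)^2 * (f 3 2 2)^2
      - f 1 1 2 * f 1 2 1 * f 2 1 1 * f 2 1 2 * f 3 2 1 * f 3 2 2
      - f 1 1 2 * f 1 2 1 * f 2 1 1 * f 2 2 1 * f 3 1 2 * f 3 2 2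
      + f 1 1 2 * f 1 2 1 * (f 2 2 2)^2 * (f 3 1 1)^2
      + 2 * f 1 1 2 * f 1 2 1 * f 2 1 1 * f 2 2 2 * f 3 1 2 * f 3 2 1
      + 2 * f 1 1 2 * f 1 2 1 * f 2 1 2 * f 2 2 1 * f 3 1 1 * f 3 2 2
      - f 1 1 2 * f 1 2 1 * f 2 1 2 * f 2 2 2 * f 3 1 1 * f 3 2 1
      - 2 * f 1 1 2 * f 1 2 1 * f 2 1 1 * f 2 2 2 * f 3 1 1 * f 3 2 2
      - f 1 1 2 * f 1 2 1 * f 2 2 1 * f 2 2 2 * f 3 1 1 * f 3 1 2
      - f 1 1 2 * f 1 2 2 * (f 2 1 1)^2 * f 3 2 1 * f 3 2 2
      + f 1 1 2 * f 1 2 2 * f 2 1 1 * f 2 2 1 * f 3 1 1 * f 3 2 2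
      + f 1 1 2 * f 1 2 2 * f 2 1 1 * f 2 1 2 * (f 3 2 1)^2
      - f 1 1 2 * f 1 2 2 * f 2 1 1 * f 2 2 1 * f 3 1 2 * f 3 2 1
      + f 1 1 2 * f 1 2 2 * f 2 1 1 * f 2 2 2 * f 3 1 1 * f 3 2 1
      - f 1 1 2 * f 1 2 2 * f 2 1 2 * f 2 2 1 * f 3 1 1 * f 3 2 1
      + f 1 1 2 * f 1 2 2 * (f 2 2 1)^2 * f 3 1 1 * f 3 1 2
      - f 1 1 2 * f 1 2 2 * f 2 2 1 * f 2 2 2 * (f 3 1 1)^2
      + (f 1 2 1)^2 * f 2 1 1 * f 2 1 2 * f 3 1 2 * f 3 2 2
      - (f 1 2 1)^2 * f 2 1 1 * f 2 2 2 * (f 3 1 2)^2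
      - (f 1 2 1)^2 * (f 2 1 2)^2 * f 3 1 1 * f 3 2 2
      + (f 1 2 1)^2 * f 2 1 2 * f 2 2 2 * f 3 1 1 * f 3 1 2
      - f 1 2 1 * f 1 2 2 * (f 2 1 1)^2 * f 3 1 2 * f 3 2 2
      + f 1 2 1 * f 1 2 2 * f 2 1 1 * f 2 1 2 * f 3 1 1 * f 3 2 2
      - f 1 2 1 * f 1 2 2 * f 2 1 1 * f 2 1 2 * f 3 1 2 * f 3 2 1
      + f 1 2 1 * f 1 2 2 * f 2 1 1 * f 2 2 1 * (f 3 1 2)^2
      + f 1 2 1 * f 1 2 2 * f 2 1 1 * f 2 2 2 * f 3 1 1 * f 3 1 2
      + f 1 2 1 * f 1 2 2 * (f 2 1 2)^2 * f 3 1 1 * f 3 2 1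
      - f 1 2 1 * f 1 2 2 * f 2 1 2 * f 2 2 1 * f 3 1 1 * f 3 1 2
      - f 1 2 1 * f 1 2 2 * f 2 1 2 * f 2 2 2 * (f 3 1 1)^2
      + (f 1 2 2)^2 * (f 2 1 1)^2 * f 3 1 2 * f 3 2 1
      - (f 1 2 2)^2 * f 2 1 1 * f 2 1 2 * f 3 1 1 * f 3 2 1
      - (f 1 2 2)^2 * f 2 1 1 * f 2 2 1 * f 3 1 1 * f 3 1 2
      + (f 1 2 2)^2 * f 2 1 2 * f 2 2 1 * (f 3 1 1)^2)"

end

theory Submission
  imports Defs "HOL-Computational_Algebra.Fundamental_Theorem_Algebra"
begin

text \<open>
  Flatten a tensor to a 3 x 4 matrix, whose columns are indexed by pairs \<open>(j, k)\<close>. Its signed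
  maximal minors form a 2 x 2 matrix in the kernel of the flattening, and the sextic is the
  determinant of that matrix. Hence it vanishes exactly at the tensors with a rank one matrix
  \<open>y \<otimes> z\<close> in the kernel. A camera tensor has such a kernel element, given by the images
  of the centre of the pinhole camera, and conversely every tensor with such a kernel element is
  a camera tensor, so no closure is needed.

  The sextic generates the vanishing ideal: along a suitable direction it is a monic polynomial of
  degree 6, and on a nonempty open set of real lines in this direction it has six distinct real roots.
  The remainder of a vanishing polynomial modulo the sextic has degree less than 6 and vanishes at
  these roots, so its coefficients vanish on a real box and are zero.

  Uniqueness: up to scalars the group acts transitively both on the complement of the sextic and on
  its points whose flattening has rank 3. An invariant hypersurface misses the first orbit, and it
  meets the second one because some line of tensors avoids the flattenings of smaller rank. The
  second orbit is dense in the sextic.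
\<close>

section \<open>Polynomial functions\<close>

lemma eval_poly_superset:
  assumes "finite S" "Poly_Mapping.keys F \<subseteq> S"
  shows "eval_poly F x =
    (\<Sum>m\<in>S. Poly_Mapping.lookup F m * (\<Prod>i\<in>UNIV. (x $ i) ^ Poly_Mapping.lookup m i))"
  unfolding eval_poly_def using assms
  by (intro sum.mono_neutral_left) (auto simp: in_keys_iff)

lemma eval_poly_0 [simp]: "eval_poly 0 x = 0"
  by (simp add: eval_poly_def)

lemma eval_poly_add [simp]: "eval_poly (F + G) x = eval_poly F x + eval_poly G x"
proof -
  let ?S = "Poly_Mapping.keys F \<union> Poly_Mapping.keys G"
  have "Poly_Mapping.keys (F + G) \<subseteq> ?S" by (rule keys_add)
  then show ?thesis
    by (simp add: eval_poly_superset[of ?S] lookup_add distrib_right sum.distrib)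
qed

lemma eval_poly_uminus [simp]: "eval_poly (- F) x = - eval_poly F x"
  by (metis add.right_inverse eval_poly_0 eval_poly_add minus_unique)

lemma eval_poly_diff [simp]: "eval_poly (F - G) x = eval_poly F x - eval_poly G x"
  using eval_poly_add[of F "- G" x] by simp

lemma eval_poly_sum [simp]: "eval_poly (sum F A) x = (\<Sum>a\<in>A. eval_poly (F a) x)"
  by (induction A rule: infinite_finite_induct) auto

lemma eval_poly_single [simp]:
  "eval_poly (Poly_Mapping.single m c) x = c * (\<Prod>i\<in>UNIV. (x $ i) ^ Poly_Mapping.lookup m i)"
  by (subst eval_poly_superset[of "{m}"]) auto

lemma eval_poly_1 [simp]: "eval_poly 1 x = 1"
  using eval_poly_single[of 0 1 x] by simp

lemma sum_single_keys: "(\<Sum>m\<in>Poly_Mapping.keys F. Poly_Mapping.single m (Poly_Mapping.lookup F m)) = F"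
  by (rule poly_mapping_eqI) (simp add: lookup_sum lookup_single when_def in_keys_iff)

lemma eval_poly_mult [simp]: "eval_poly (F * G) x = eval_poly F x * eval_poly G x"
proof -
  let ?s = "\<lambda>F m. Poly_Mapping.single m (Poly_Mapping.lookup F m)"
  have "F * G = (\<Sum>m\<in>Poly_Mapping.keys F. ?s F m) * (\<Sum>n\<in>Poly_Mapping.keys G. ?s G n)"
    by (simp add: sum_single_keys)
  also have "eval_poly \<dots> x = (\<Sum>m\<in>Poly_Mapping.keys F. eval_poly (?s F m) x) *
      (\<Sum>n\<in>Poly_Mapping.keys G. eval_poly (?s G n) x)"
    unfolding sum_product
    by (simp add: mult_single lookup_add power_add prod.distrib mult_ac)
  also have "\<dots> = eval_poly F x * eval_poly G x"
    unfolding eval_poly_sum[symmetric] sum_single_keys ..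
  finally show ?thesis .
qed

lemma eval_poly_var [simp]: "eval_poly (var i) x = x $ i"
proof -
  have "(\<Prod>k\<in>UNIV. (x $ k) ^ (if i = k then Suc 0 else 0)) = (\<Prod>k\<in>UNIV. if k = i then x $ k else 1)"
    by (intro prod.cong) auto
  also have "\<dots> = x $ i" by (simp add: prod.delta)
  finally show ?thesis by (simp add: var_def lookup_single when_def)
qed

section \<open>Homogeneity and restriction to lines\<close>

lemma homogeneous_add: "homogeneous d F \<Longrightarrow> homogeneous d G \<Longrightarrow> homogeneous d (F + G)"
  unfolding homogeneous_def using keys_add[of F G] by blast

lemma homogeneous_uminus: "homogeneous d F \<Longrightarrow> homogeneous d (- F)"
  unfolding homogeneous_def by (simp add: in_keys_iff)

lemma homogeneous_diff: "homogeneous d F \<Longrightarrow> homogeneous d G \<Longrightarrow> homogeneous d (F - G)"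
  using homogeneous_add[of d F "- G"] homogeneous_uminus[of d G] by simp

lemma homogeneous_mult:
  "homogeneous d F \<Longrightarrow> homogeneous e G \<Longrightarrow> homogeneous (d + e) (F * G)"
  unfolding homogeneous_def using keys_mult[of F G] by (force simp: lookup_add sum.distrib)

lemma homogeneous_var: "homogeneous 1 (var i)"
  by (simp add: homogeneous_def var_def lookup_single when_def)

lemma eval_poly_homogeneous:
  assumes "homogeneous d F"
  shows "eval_poly F (c *s x) = c ^ d * eval_poly F x"
  using assms unfolding homogeneous_def eval_poly_def
  by (auto simp: sum_distrib_left power_mult_distrib prod.distrib power_sum[symmetric] mult_ac
      intro!: sum.cong)

text \<open>Reduces density arguments and the search for zeros to univariate polynomials along a
  line.\<close>

lemma eval_poly_line: "\<exists>p. \<forall>s. poly p s = eval_poly F (x + s *s y)"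
proof
  show "\<forall>s. poly (\<Sum>m\<in>Poly_Mapping.keys F. smult (Poly_Mapping.lookup F m)
      (\<Prod>i\<in>UNIV. [:x $ i, y $ i:] ^ Poly_Mapping.lookup m i)) s = eval_poly F (x + s *s y)"
    by (simp add: eval_poly_def poly_sum poly_prod mult.commute)
qed

text \<open>Exponent vectors are plain functions here, so that the induction can erase one coordinate.\<close>

lemma coeffs_zero_if_zero_on_box:
  fixes S :: "'i \<Rightarrow> 'a::idom set"
  assumes "\<And>i. infinite (S i)" "finite I" "finite M" "\<And>m i. m \<in> M \<Longrightarrow> i \<notin> I \<Longrightarrow> m i = 0"
    and "\<And>x. (\<And>i. x i \<in> S i) \<Longrightarrow> (\<Sum>m\<in>M. c m * (\<Prod>i\<in>I. x i ^ m i)) = 0"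
    and "m \<in> M"
  shows "c m = 0"
  using assms(2-)
proof (induction I arbitrary: M c m rule: finite_induct)
  case empty
  have "n = m" if "n \<in> M" for n
    using empty.prems(2)[OF that] empty.prems(2)[OF empty.prems(4)] by (simp add: fun_eq_iff)
  then have "M = {m}" using empty.prems(4) by blast
  moreover have "\<exists>x. \<forall>i. x i \<in> S i" 
    by (intro choice allI) (metis assms(1) all_not_in_conv finite.emptyI)
  ultimately show ?case using empty.prems(3) by fastforce
next
  case (insert j I)
  let ?k = "m j"
  let ?N = "{n \<in> M. n j = ?k}"
  let ?e = "\<lambda>n. n(j := 0 :: nat)"
  \<comment> \<open>All members of \<open>?N\<close> have the same exponent \<open>?k\<close> at
    \<open>j\<close>, so an erased exponent can be restored.\<close>
  have inj: "inj_on ?e ?N"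
    by (rule inj_onI) (metis (mono_tags, lifting) fun_upd_triv fun_upd_upd mem_Collect_eq)
  have "(\<lambda>n. c (n(j := ?k))) (?e m) = 0"
  proof (rule insert.IH[where M = "?e ` ?N" and c = "\<lambda>n. c (n(j := ?k))" and m = "?e m"])
    show "finite (?e ` ?N)" "?e m \<in> ?e ` ?N" using insert.prems by auto
    show "n i = 0" if "n \<in> ?e ` ?N" "i \<notin> I" for n i
      using that insert.prems(2) by auto
    fix x :: "'i \<Rightarrow> 'a" assume x: "\<And>i. x i \<in> S i"
    \<comment> \<open>With the other coordinates fixed, this is the whole sum as a polynomial in
      coordinate \<open>j\<close>. It vanishes on the infinite set \<open>S j\<close>, so its
      coefficient at \<open>?k\<close> is zero; that coefficient is the sum over the exponents
      without \<open>j\<close>.\<close>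
    let ?p = "\<Sum>n\<in>M. monom (c n * (\<Prod>i\<in>I. x i ^ n i)) (n j)"
    have "poly ?p s = 0" if "s \<in> S j" for s
    proof -
      have "poly ?p s = (\<Sum>n\<in>M. c n * (\<Prod>i\<in>insert j I. (x(j := s)) i ^ n i))"
        unfolding poly_sum
      proof (rule sum.cong[OF refl])
        fix n
        have "(\<Prod>i\<in>I. (x(j := s)) i ^ n i) = (\<Prod>i\<in>I. x i ^ n i)"
          using insert.hyps by (intro prod.cong) auto
        then show "poly (monom (c n * (\<Prod>i\<in>I. x i ^ n i)) (n j)) s =
            c n * (\<Prod>i\<in>insert j I. (x(j := s)) i ^ n i)"
          using insert.hyps by (simp add: poly_monom)
      qed
      also have "\<dots> = 0" using insert.prems(3)[of "x(j := s)"] x that by simp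
      finally show ?thesis .
    qed
    then have "S j \<subseteq> {s. poly ?p s = 0}" by auto
    then have "?p = 0" using assms(1) finite_subset poly_roots_finite by blast
    then have "coeff ?p ?k = 0" by simp
    then have "(\<Sum>n\<in>M. if n j = ?k then c n * (\<Prod>i\<in>I. x i ^ n i) else 0) = 0"
      by (simp add: coeff_sum)
    then have "(\<Sum>n\<in>?N. c n * (\<Prod>i\<in>I. x i ^ n i)) = 0"
      using insert.prems(1) by (simp add: sum.inter_filter)
    also have "(\<Sum>n\<in>?N. c n * (\<Prod>i\<in>I. x i ^ n i)) =
        (\<Sum>n\<in>?N. c ((?e n)(j := ?k)) * (\<Prod>i\<in>I. x i ^ (?e n) i))"
    proof (rule sum.cong[OF refl])
      fix n assume "n \<in> ?N"
      then have "(?e n)(j := ?k) = n" by auto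
      moreover have "(\<Prod>i\<in>I. x i ^ n i) = (\<Prod>i\<in>I. x i ^ (?e n) i)"
        using insert.hyps by (intro prod.cong) auto
      ultimately show "c n * (\<Prod>i\<in>I. x i ^ n i) = c ((?e n)(j := ?k)) * (\<Prod>i\<in>I. x i ^ (?e n) i)"
        by simp
    qed
    also have "\<dots> = (\<Sum>n\<in>?e ` ?N. c (n(j := ?k)) * (\<Prod>i\<in>I. x i ^ n i))"
      by (subst sum.reindex[OF inj]) simp
    finally show "(\<Sum>n\<in>?e ` ?N. c (n(j := ?k)) * (\<Prod>i\<in>I. x i ^ n i)) = 0" .
  qed
  then show ?case by simp
qed

text \<open>The sides only have to be infinite: they are the whole complex plane when polynomials
  are compared by their values, and real intervals when the vanishing ideal is determined.\<close>

lemma poly_eq_0_if_zero_on_box: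
  fixes F :: "'i::finite cpoly"
  assumes inf: "\<And>i. infinite (S i)" and zero: "\<And>x. (\<And>i. x $ i \<in> S i) \<Longrightarrow> eval_poly F x = 0"
  shows "F = 0"
proof (rule ccontr)
  assume "F \<noteq> 0"
  then obtain m where m: "m \<in> Poly_Mapping.keys F" by fastforce
  let ?M = "Poly_Mapping.lookup ` Poly_Mapping.keys F"
  have inj: "inj_on Poly_Mapping.lookup A" for A :: "('i \<Rightarrow>\<^sub>0 nat) set"
    by (simp add: inj_on_def poly_mapping_eqI)
  have "(\<lambda>n. Poly_Mapping.lookup F (Abs_poly_mapping n)) (Poly_Mapping.lookup m) = 0"
  proof (rule coeffs_zero_if_zero_on_box[where I = UNIV and S = S and M = ?M])
    fix x assume "\<And>i. x i \<in> S i"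
    then have "eval_poly F (\<chi> i. x i) = 0" by (intro zero) simp
    then show "(\<Sum>n\<in>?M. Poly_Mapping.lookup F (Abs_poly_mapping n) * (\<Prod>i\<in>UNIV. x i ^ n i)) = 0"
      by (simp add: sum.reindex[OF inj] eval_poly_def)
  qed (use m inf in auto)
  then show False using m by (simp add: in_keys_iff)
qed

lemma cpoly_eqI:
  assumes "\<And>x. eval_poly F x = eval_poly G x"
  shows "F = G"
  using poly_eq_0_if_zero_on_box[of "\<lambda>_. UNIV" "F - G"] assms infinite_UNIV_char_0 by auto

section \<open>Projective points and zero loci of forms\<close>

lemma proj_space_iff: "L \<in> proj_space \<longleftrightarrow> (\<exists>x. x \<noteq> 0 \<and> L = vec.span {x})"
proof
  assume L: "L \<in> proj_space"
  then have sub: "vec.subspace L" and dim: "vec.dim L = 1" by (auto simp: proj_space_def)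
  obtain B where B: "B \<subseteq> L" "vec.independent B" "vec.span B = L" "card B = 1"
    using vec.basis_exists[of L] vec.span_subspace[OF _ _ sub] dim by metis
  then obtain x where "B = {x}" by (auto simp: card_1_singleton_iff)
  then show "\<exists>x. x \<noteq> 0 \<and> L = vec.span {x}" using B by (auto simp: vec.dependent_single)
next
  assume "\<exists>x. x \<noteq> 0 \<and> L = vec.span {x}"
  then obtain x where x: "x \<noteq> 0" "L = vec.span {x}" by blast
  have "vec.dim (vec.span {x}) = card {x}"
    using x by (simp only: vec.dim_span, intro vec.dim_eq_card_independent) (simp add: vec.dependent_single)
  then show "L \<in> proj_space" using x by (simp add: proj_space_def)
qed

lemma mem_span_single: "y \<in> vec.span {x} \<longleftrightarrow> (\<exists>c. y = c *s x)"
  by (auto simp: vec.span_singleton)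

lemma span_mem_zero_locus_iff:
  assumes "homogeneous d F" "x \<noteq> 0"
  shows "vec.span {x} \<in> zero_locus {F} \<longleftrightarrow> eval_poly F x = 0"
proof -
  have "vec.span {x} \<in> proj_space" using assms(2) proj_space_iff by blast
  moreover have "(\<forall>y\<in>vec.span {x}. eval_poly F y = 0) \<longleftrightarrow> eval_poly F x = 0"
    using eval_poly_homogeneous[OF assms(1)] by (auto simp: mem_span_single intro: vec.span_base)
  ultimately show ?thesis by (simp add: zero_locus_def)
qed

lemma zero_locus_eq:
  assumes "homogeneous d F"
  shows "zero_locus {F} = {vec.span {x} | x. x \<noteq> 0 \<and> eval_poly F x = 0}"
proof -
  have "zero_locus {F} \<subseteq> proj_space" by (auto simp: zero_locus_def)
  then show ?thesis using span_mem_zero_locus_iff[OF assms] by (auto simp: proj_space_iff subset_iff)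
qed

section \<open>The hyperdeterminant\<close>

text \<open>Expanded along the first column, so that ring homomorphisms, homogeneity and degree
  bounds pass through it term by term.\<close>

definition det_cols :: "(3 \<Rightarrow> 'a::comm_ring_1) \<Rightarrow> (3 \<Rightarrow> 'a) \<Rightarrow> (3 \<Rightarrow> 'a) \<Rightarrow> 'a" where
  "det_cols a b c =
     a 1 * (b 2 * c 3 - b 3 * c 2) - a 2 * (b 1 * c 3 - b 3 * c 1) + a 3 * (b 1 * c 2 - b 2 * c 1)"

text \<open>The signs alternate in the column order 11, 12, 21, 22, as Cramer's rule demands for a
  kernel element.\<close>

definition minor :: "(tensor_index \<Rightarrow> 'a::comm_ring_1) \<Rightarrow> 2 \<Rightarrow> 2 \<Rightarrow> 'a" where
  "minor f j k =
     (let c = (\<lambda>j k i. f (i, j, k)) in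
      if j = 1 then if k = 1 then det_cols (c 1 2) (c 2 1) (c 2 2) else - det_cols (c 1 1) (c 2 1) (c 2 2)
      else if k = 1 then det_cols (c 1 1) (c 1 2) (c 2 2) else - det_cols (c 1 1) (c 1 2) (c 2 1))"

text \<open>Cayley's hyperdeterminant of format 3 x 2 x 2. The coefficient ring is arbitrary because
  the entries will be variables, real or complex numbers, and univariate polynomials over the
  polynomial ring.\<close>

definition hyperdet :: "(tensor_index \<Rightarrow> 'a::comm_ring_1) \<Rightarrow> 'a" where
  "hyperdet f = minor f 1 1 * minor f 2 2 - minor f 1 2 * minor f 2 1"

lemmas hyperdet_defs = hyperdet_def minor_def det_cols_def Let_def

lemma camera_poly_eq: "camera_poly = hyperdet var"
  unfolding camera_poly_def hyperdet_defs
  by (simp only: if_True if_False simp_thms zero_neq_one one_neq_zero) (simp add: algebra_simps power2_eq_square)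

definition rank_three :: "(tensor_index \<Rightarrow> 'a::comm_ring_1) \<Rightarrow> bool" where
  "rank_three f \<longleftrightarrow> (\<forall>x. (\<forall>j k. (\<Sum>i\<in>UNIV. x i * f (i, j, k)) = 0) \<longrightarrow> x = (\<lambda>i. 0))"

definition kernel :: "(tensor_index \<Rightarrow> 'a::comm_ring_1) \<Rightarrow> (2 \<Rightarrow> 2 \<Rightarrow> 'a) \<Rightarrow> bool" where
  "kernel f m \<longleftrightarrow> (\<forall>i. (\<Sum>j\<in>UNIV. \<Sum>k\<in>UNIV. f (i, j, k) * m j k) = 0)"

text \<open>For each \<open>i\<close> the sum is the expansion of a 4 x 4 determinant in which row
  \<open>i\<close> of the flattening occurs twice.\<close>

lemma kernel_minor: "kernel f (minor f)"
  unfolding kernel_def forall_3 sum_2 by (simp add: minor_def det_cols_def) (simp add: algebra_simps)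

lemma hyperdet_hom:
  assumes "\<And>x y. h (x + y) = h x + h y" "\<And>x y. h (x - y) = h x - h y" "\<And>x y. h (x * y) = h x * h y"
   "\<And>x. h (- x) = - h x"
  shows "h (hyperdet f) = hyperdet (\<lambda>p. h (f p))"
  by (simp add: hyperdet_defs assms)

lemma forall_2: "(\<forall>i::2. P i) \<longleftrightarrow> P 1 \<and> P 2"
  by (metis exhaust_2)

lemma det_eq_0_iff:
  fixes M :: "'a::field^'n^'n"
  shows "det M = 0 \<longleftrightarrow> (\<exists>x. x \<noteq> 0 \<and> M *v x = 0)"
  by (metis invertible_det_nz invertible_left_inverse matrix_left_invertible_ker)

lemma det_cols_eq_det: "det_cols a b c = det (\<chi> i j. if j = 1 then a i else if j = 2 then b i else c i)"
  by (simp add: det_3 det_cols_def algebra_simps)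

lemma det_cols_kernel:
  fixes a b c :: "3 \<Rightarrow> 'a::field"
  assumes "det_cols a b c = 0"
  obtains u v w where "(u, v, w) \<noteq> (0, 0, 0)" "\<And>i. a i * u + b i * v + c i * w = 0"
proof -
  define M :: "'a^3^3" where "M = (\<chi> i j. if j = 1 then a i else if j = 2 then b i else c i)"
  have "det M = 0" using assms by (simp add: det_cols_eq_det M_def)
  then obtain x where x: "x \<noteq> 0" "M *v x = 0" using det_eq_0_iff by blast
  show thesis
  proof (rule that)
    show "(x $ 1, x $ 2, x $ 3) \<noteq> (0, 0, 0)"
      using x(1) by (auto simp: vec_eq_iff forall_3)
    fix i
    have "(M *v x) $ i = a i * x $ 1 + b i * x $ 2 + c i * x $ 3"
      by (simp add: M_def matrix_vector_mult_def sum_3)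
    then show "a i * x $ 1 + b i * x $ 2 + c i * x $ 3 = 0" using x(2) by simp
  qed
qed

abbreviation det2 :: "(2 \<Rightarrow> 2 \<Rightarrow> 'a::comm_ring_1) \<Rightarrow> 'a" where
  "det2 m \<equiv> m 1 1 * m 2 2 - m 1 2 * m 2 1"

text \<open>By linearity both terms merge into one determinant. Adding multiples of \<open>p\<close>
  and \<open>q\<close> to its first column does not change it and makes that column zero.\<close>

lemma det_cols_relation:
  fixes p q a b :: "3 \<Rightarrow> 'a::comm_ring_1"
  assumes "\<And>i. a i * x + b i * y + p i * u + q i * v = 0"
  shows "det_cols a p q * x + det_cols b p q * y = 0"
proof -
  have "det_cols a p q * x + det_cols b p q * y = det_cols (\<lambda>i. a i * x + b i * y + p i * u + q i * v) p q"
    by (simp add: det_cols_def algebra_simps)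
  then show ?thesis by (simp add: assms det_cols_def)
qed

lemma det_cols_swap: "det_cols b a c = - det_cols a b c" "det_cols a c b = - det_cols a b c"
  by (simp_all add: det_cols_def algebra_simps)

text \<open>Cramer's rule without a case distinction on the rank. Each pair of positions is one
  instance of \<open>det_cols_relation\<close>, with the columns of the pair in front; the swaps
  only restore the order of columns.\<close>

lemma minor_proportional:
  assumes "kernel f v"
  shows "minor f a b * v c d = minor f c d * v a b"
proof -
  let ?c = "\<lambda>j k i. f (i, j, k)"
  have e: "?c 1 1 i * v 1 1 + ?c 1 2 i * v 1 2 + ?c 2 1 i * v 2 1 + ?c 2 2 i * v 2 2 = 0" for i
    using assms by (simp add: kernel_def sum_2 add.assoc)
  note r = det_cols_relation
  have "minor f 1 1 * v 1 2 = minor f 1 2 * v 1 1"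
    using r[of "?c 1 1" "v 1 1" "?c 1 2" "v 1 2" "?c 2 1" "v 2 1" "?c 2 2" "v 2 2"] e
    by (simp add: minor_def algebra_simps eq_neg_iff_add_eq_0)
  moreover have "minor f 1 1 * v 2 1 = minor f 2 1 * v 1 1"
    using r[of "?c 1 1" "v 1 1" "?c 2 1" "v 2 1" "?c 1 2" "v 1 2" "?c 2 2" "v 2 2"] e
    by (simp add: minor_def algebra_simps det_cols_swap(1)[of "?c 2 1" "?c 1 2"])
  moreover have "minor f 1 1 * v 2 2 = minor f 2 2 * v 1 1"
    using r[of "?c 1 1" "v 1 1" "?c 2 2" "v 2 2" "?c 1 2" "v 1 2" "?c 2 1" "v 2 1"] e
    by (simp add: minor_def algebra_simps det_cols_swap(1)[of "?c 2 2"] det_cols_swap(2)[of _ "?c 2 2"]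
        eq_neg_iff_add_eq_0)
  moreover have "minor f 1 2 * v 2 1 = minor f 2 1 * v 1 2"
    using r[of "?c 1 2" "v 1 2" "?c 2 1" "v 2 1" "?c 1 1" "v 1 1" "?c 2 2" "v 2 2"] e
    by (simp add: minor_def algebra_simps det_cols_swap(1)[of _ "?c 1 1"]) (metis minus_minus)
  moreover have "minor f 1 2 * v 2 2 = minor f 2 2 * v 1 2"
    using r[of "?c 1 2" "v 1 2" "?c 2 2" "v 2 2" "?c 1 1" "v 1 1" "?c 2 1" "v 2 1"] e
    by (simp add: minor_def algebra_simps det_cols_swap(1)[of _ "?c 1 1"] det_cols_swap(2)[of _ "?c 2 2"]
       eq_neg_iff_add_eq_0)
  moreover have "minor f 2 1 * v 2 2 = minor f 2 2 * v 2 1"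
    using r[of "?c 2 1" "v 2 1" "?c 2 2" "v 2 2" "?c 1 1" "v 1 1" "?c 1 2" "v 1 2"] e
    by (simp add: minor_def algebra_simps det_cols_swap(1)[of _ "?c 1 1"] det_cols_swap(2)[of _ _ "?c 1 2"]
       eq_neg_iff_add_eq_0)
  ultimately have *: "minor f 1 1 * v 1 2 = minor f 1 2 * v 1 1" "minor f 1 1 * v 2 1 = minor f 2 1 * v 1 1"
    "minor f 1 1 * v 2 2 = minor f 2 2 * v 1 1" "minor f 1 2 * v 2 1 = minor f 2 1 * v 1 2"
    "minor f 1 2 * v 2 2 = minor f 2 2 * v 1 2" "minor f 2 1 * v 2 2 = minor f 2 2 * v 2 1" .
  have "\<forall>a b c d. minor f a b * v c d = minor f c d * v a b"
    unfolding forall_2 by (intro conjI; (rule refl | rule * | rule *[symmetric]))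
  then show ?thesis by blast
qed

text \<open>The factors are the column and the scaled row through a nonzero entry.\<close>

lemma rank_one_matrix:
  fixes m :: "2 \<Rightarrow> 2 \<Rightarrow> 'a::field"
  assumes "det2 m = 0" "m \<noteq> (\<lambda>j k. 0)"
  obtains y z where "y \<noteq> (\<lambda>j. 0)" "z \<noteq> (\<lambda>k. 0)" "m = (\<lambda>j k. y j * z k)"
proof -
  obtain a b where ab: "m a b \<noteq> 0" using assms(2) by (auto simp: fun_eq_iff)
  have *: "m j k * m a b = m j b * m a k" for j k
  proof -
    have "m 1 1 * m 2 2 = m 1 2 * m 2 1" using assms(1) by simp
    then have "\<forall>a b j k. m j k * m a b = m j b * m a k"
      by (simp add: forall_2 mult.commute)
    then show ?thesis by blast
  qed
  show thesis
  proof (rule that)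
    show "(\<lambda>j. m j b) \<noteq> (\<lambda>j. 0)" "(\<lambda>k. m a k / m a b) \<noteq> (\<lambda>k. 0)" using ab by (auto simp: fun_eq_iff)
    have "m j k = m j b * (m a k / m a b)" for j k
      using *[of j k] ab by (simp add: eq_divide_eq)
    then show "m = (\<lambda>j k. m j b * (m a k / m a b))" by blast
  qed
qed

text \<open>A vanishing minor is a linear dependence among the other three columns; padding it with
  0 at the omitted position gives the kernel element.\<close>

lemma kernel_with_zero_entry:
  fixes f :: "tensor_index \<Rightarrow> 'a::field"
  assumes "minor f a b = 0"
  obtains m where "kernel f m" "m \<noteq> (\<lambda>j k. 0)" "m a b = 0"
proof -
  let ?c = "\<lambda>j k i. f (i, j, k)"
  consider "a = 1" "b = 1" | "a = 1" "b = 2" | "a = 2" "b = 1" | "a = 2" "b = 2"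
    using exhaust_2[of a] exhaust_2[of b] by blast
  then show thesis
  proof cases
    case 1
    then have "det_cols (?c 1 2) (?c 2 1) (?c 2 2) = 0" using assms by (simp add: minor_def)
    then obtain u v w where uvw: "(u, v, w) \<noteq> (0, 0, 0)"
      "\<And>i. ?c 1 2 i * u + ?c 2 1 i * v + ?c 2 2 i * w = 0"
      by (rule det_cols_kernel) blast
    let ?m = "\<lambda>(j::2) (k::2). if j = 1 then if k = 1 then 0 else u else if k = 1 then v else w"
    have "kernel f ?m" using uvw(2) by (simp add: kernel_def sum_2 add.assoc)
    moreover have "?m \<noteq> (\<lambda>j k. 0)"
    proof
      assume 0: "?m = (\<lambda>j k. 0)"
      show False
        using uvw(1) fun_cong[OF fun_cong[OF 0], of 1 2] fun_cong[OF fun_cong[OF 0], of 2 1] fun_cong[OF fun_cong[OF 0], of 2 2]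
        by simp
    qed
    ultimately show thesis using that 1 by simp
  next
    case 2
    then have "det_cols (?c 1 1) (?c 2 1) (?c 2 2) = 0" using assms by (simp add: minor_def)
    then obtain u v w where uvw: "(u, v, w) \<noteq> (0, 0, 0)"
      "\<And>i. ?c 1 1 i * u + ?c 2 1 i * v + ?c 2 2 i * w = 0"
      by (rule det_cols_kernel) blast
    let ?m = "\<lambda>(j::2) (k::2). if j = 1 then if k = 1 then u else 0 else if k = 1 then v else w"
    have "kernel f ?m" using uvw(2) by (simp add: kernel_def sum_2 add.assoc)
    moreover have "?m \<noteq> (\<lambda>j k. 0)"
    proof
      assume 0: "?m = (\<lambda>j k. 0)"
      show False
        using uvw(1) fun_cong[OF fun_cong[OF 0], of 1 1] fun_cong[OF fun_cong[OF 0], of 2 1] fun_cong[OF fun_cong[OF 0], of 2 2]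
        by simp
    qed
    ultimately show thesis using that 2 by simp
  next
    case 3
    then have "det_cols (?c 1 1) (?c 1 2) (?c 2 2) = 0" using assms by (simp add: minor_def)
    then obtain u v w where uvw: "(u, v, w) \<noteq> (0, 0, 0)"
      "\<And>i. ?c 1 1 i * u + ?c 1 2 i * v + ?c 2 2 i * w = 0"
      by (rule det_cols_kernel) blast
    let ?m = "\<lambda>(j::2) (k::2). if j = 1 then if k = 1 then u else v else if k = 1 then 0 else w"
    have "kernel f ?m" using uvw(2) by (simp add: kernel_def sum_2 add.assoc)
    moreover have "?m \<noteq> (\<lambda>j k. 0)"
    proof
      assume 0: "?m = (\<lambda>j k. 0)"
      show False
        using uvw(1) fun_cong[OF fun_cong[OF 0], of 1 1] fun_cong[OF fun_cong[OF 0], of 1 2] fun_cong[OF fun_cong[OF 0], of 2 2]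
        by simp
    qed
    ultimately show thesis using that 3 by simp
  next
    case 4
    then have "det_cols (?c 1 1) (?c 1 2) (?c 2 1) = 0" using assms by (simp add: minor_def)
    then obtain u v w where uvw: "(u, v, w) \<noteq> (0, 0, 0)"
      "\<And>i. ?c 1 1 i * u + ?c 1 2 i * v + ?c 2 1 i * w = 0"
      by (rule det_cols_kernel) blast
    let ?m = "\<lambda>(j::2) (k::2). if j = 1 then if k = 1 then u else v else if k = 1 then w else 0"
    have "kernel f ?m" using uvw(2) by (simp add: kernel_def sum_2 add.assoc)
    moreover have "?m \<noteq> (\<lambda>j k. 0)"
    proof
      assume 0: "?m = (\<lambda>j k. 0)"
      show False
        using uvw(1) fun_cong[OF fun_cong[OF 0], of 1 1] fun_cong[OF fun_cong[OF 0], of 1 2] fun_cong[OF fun_cong[OF 0], of 2 1]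
        by simp
    qed
    ultimately show thesis using that 4 by simp
  qed
qed

text \<open>If some minor is nonzero, the minors themselves serve. If all vanish, the kernel
  contains two independent matrices, and over the complex numbers some nonzero combination of them
  is singular.\<close>

lemma singular_kernel_element:
  fixes f :: "tensor_index \<Rightarrow> complex"
  assumes "hyperdet f = 0"
  obtains m where "kernel f m" "m \<noteq> (\<lambda>j k. 0)" "det2 m = 0"
proof (cases "minor f = (\<lambda>j k. 0)")
  case False
  then show thesis using that[of "minor f"] kernel_minor[of f] assms by (simp add: hyperdet_def)
next
  case True
  obtain u where u: "kernel f u" "u \<noteq> (\<lambda>j k. 0)"
    using kernel_with_zero_entry[of f 1 1] True by metis
  then obtain a b where ab: "u a b \<noteq> 0" by (auto simp: fun_eq_iff)
  \<comment> \<open>Vanishing at a position where \<open>u\<close> does not makes \<open>w\<close>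
    independent of \<open>u\<close>.\<close>
  obtain w where w: "kernel f w" "w \<noteq> (\<lambda>j k. 0)" "w a b = 0"
    using kernel_with_zero_entry[of f a b] True by metis
  show thesis
  proof (cases "det2 u = 0")
    case True
    then show thesis using that u by blast
  next
    case False
    \<comment> \<open>The determinant of \<open>s * u + w\<close> as a polynomial in
      \<open>s\<close>; its quadratic coefficient is \<open>det2 u\<close>.\<close>
    let ?p = "[:det2 w, u 1 1 * w 2 2 + w 1 1 * u 2 2 - u 1 2 * w 2 1 - w 1 2 * u 2 1, det2 u:]"
    have "\<not> constant (poly ?p)" using False by (simp add: constant_degree)
    then obtain s where s: "poly ?p s = 0" using fundamental_theorem_of_algebra by blast
    show thesis
    proof (rule that)
      let ?m = "\<lambda>j k. s * u j k + w j k"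
      show "kernel f ?m"
        using u(1) w(1)
        by (simp add: kernel_def distrib_left sum.distrib mult.left_commute[of _ s] flip: sum_distrib_left)
      show "?m \<noteq> (\<lambda>j k. 0)"
      proof
        assume m: "?m = (\<lambda>j k. 0)"
        then have "s * u a b + w a b = 0" by meson
        then have "s = 0" using ab w(3) by simp
        then show False using m w(2) by simp
      qed
      show "det2 ?m = 0" using s by (simp add: algebra_simps)
    qed
  qed
qed

lemma hyperdet_eq_0_iff:
  fixes f :: "tensor_index \<Rightarrow> complex"
  shows "hyperdet f = 0 \<longleftrightarrow>
    (\<exists>y z. y \<noteq> (\<lambda>j. 0) \<and> z \<noteq> (\<lambda>k. 0) \<and> kernel f (\<lambda>j k. y j * z k))"
proof
  assume "hyperdet f = 0"
  then obtain m where m: "kernel f m" "m \<noteq> (\<lambda>j k. 0)" "det2 m = 0"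
    using singular_kernel_element by blast
  then show "\<exists>y z. y \<noteq> (\<lambda>j. 0) \<and> z \<noteq> (\<lambda>k. 0) \<and> kernel f (\<lambda>j k. y j * z k)"
    using rank_one_matrix[OF m(3,2)] by metis
next
  assume "\<exists>y z. y \<noteq> (\<lambda>j. 0) \<and> z \<noteq> (\<lambda>k. 0) \<and> kernel f (\<lambda>j k. y j * z k)"
  then obtain y z where yz: "y \<noteq> (\<lambda>j. 0)" "z \<noteq> (\<lambda>k. 0)" and ker: "kernel f (\<lambda>j k. y j * z k)"
    by blast
  obtain a b where ab: "y a \<noteq> 0" "z b \<noteq> 0" using yz by (auto simp: fun_eq_iff)
  \<comment> \<open>The matrix of minors is \<open>r\<close> times the rank one matrix, so its
    determinant vanishes, also when \<open>r\<close> is 0.\<close>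
  define r where "r = minor f a b / (y a * z b)"
  have "minor f j k = r * (y j * z k)" for j k
    using minor_proportional[OF ker, of a b j k] ab by (simp add: r_def field_simps)
  then show "hyperdet f = 0" by (simp add: hyperdet_def)
qed

section \<open>Camera tensors\<close>

lemma eval_camera_poly: "eval_poly camera_poly t = hyperdet (($) t)"
  using hyperdet_hom[of "\<lambda>F. eval_poly F t" var] by (simp add: camera_poly_eq)

lemma homogeneous_camera_poly: "homogeneous 6 camera_poly"
proof -
  have "homogeneous 3 (det_cols (\<lambda>i. var (i, p)) (\<lambda>i. var (i, q)) (\<lambda>i. var (i, r :: 2 \<times> 2)))"
    for p q r
  proof -
    have "homogeneous (1 + (1 + 1)) (det_cols (\<lambda>i. var (i, p)) (\<lambda>i. var (i, q)) (\<lambda>i. var (i, r)))"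
      unfolding det_cols_def
      by (intro homogeneous_add homogeneous_diff homogeneous_mult homogeneous_var)
    then show ?thesis by (simp add: numeral_3_eq_3)
  qed
  then have "homogeneous 3 (minor var j k :: tensor_index cpoly)" for j k
    by (simp add: minor_def homogeneous_uminus)
  then have "homogeneous (3 + 3) camera_poly"
    unfolding camera_poly_eq hyperdet_def by (intro homogeneous_diff homogeneous_mult)
  then show ?thesis by simp
qed

lemma vector_4:
  "(vector [p, q, r, s] :: 'a::zero^4) $ 1 = p"
  "(vector [p, q, r, s] :: 'a::zero^4) $ 2 = q"
  "(vector [p, q, r, s] :: 'a::zero^4) $ 3 = r"
  "(vector [p, q, r, s] :: 'a::zero^4) $ 4 = s"
  unfolding vector_def by simp_all

lemma det_4:
  "det (M :: 'a::comm_ring_1^4^4) =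
    M$1$1 * M$2$2 * M$3$3 * M$4$4 - M$1$1 * M$2$2 * M$3$4 * M$4$3
  - M$1$1 * M$2$3 * M$3$2 * M$4$4 + M$1$1 * M$2$3 * M$3$4 * M$4$2
  + M$1$1 * M$2$4 * M$3$2 * M$4$3 - M$1$1 * M$2$4 * M$3$3 * M$4$2
  - M$1$2 * M$2$1 * M$3$3 * M$4$4 + M$1$2 * M$2$1 * M$3$4 * M$4$3
  + M$1$2 * M$2$3 * M$3$1 * M$4$4 - M$1$2 * M$2$3 * M$3$4 * M$4$1
  - M$1$2 * M$2$4 * M$3$1 * M$4$3 + M$1$2 * M$2$4 * M$3$3 * M$4$1
  + M$1$3 * M$2$1 * M$3$2 * M$4$4 - M$1$3 * M$2$1 * M$3$4 * M$4$2
  - M$1$3 * M$2$2 * M$3$1 * M$4$4 + M$1$3 * M$2$2 * M$3$4 * M$4$1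
  + M$1$3 * M$2$4 * M$3$1 * M$4$2 - M$1$3 * M$2$4 * M$3$2 * M$4$1
  - M$1$4 * M$2$1 * M$3$2 * M$4$3 + M$1$4 * M$2$1 * M$3$3 * M$4$2
  + M$1$4 * M$2$2 * M$3$1 * M$4$3 - M$1$4 * M$2$2 * M$3$3 * M$4$1
  - M$1$4 * M$2$3 * M$3$1 * M$4$2 + M$1$4 * M$2$3 * M$3$2 * M$4$1"
proof -
  have f1: "finite {2::4, 3, 4}" "1 \<notin> {2::4, 3, 4}" by auto
  have f2: "finite {3::4, 4}" "2 \<notin> {3::4, 4}" by auto
  have f3: "finite {4::4}" "3 \<notin> {4::4}" by auto
  show ?thesis
    unfolding det_def UNIV_4
    unfolding sum_over_permutations_insert[OF f1]
    unfolding sum_over_permutations_insert[OF f2]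
    unfolding sum_over_permutations_insert[OF f3]
    unfolding permutes_sing
    by (simp add: sign_swap_id permutation_swap_id permutation_compose sign_compose sign_id swap_id_eq algebra_simps)
qed

abbreviation det_rows :: "'a::comm_ring_1^4 \<Rightarrow> 'a^4 \<Rightarrow> 'a^4 \<Rightarrow> 'a^4 \<Rightarrow> 'a" where
  "det_rows p q r s \<equiv> det (vector [p, q, r, s] :: 'a^4^4)"

lemma det_rows_bilinear:
  "det_rows p q (a *s r - b *s r') (c *s s - d *s s') =
     a * c * det_rows p q r s - a * d * det_rows p q r s' - b * c * det_rows p q r' s + b * d * det_rows p q r' s'"
  unfolding det_4 vector_4 by (simp add: algebra_simps)

lemma det_rows_eq_0:
  fixes a :: "'a::field^4"
  assumes "a \<noteq> 0" "\<forall>v\<in>{p, q, r, s}. (\<Sum>i\<in>UNIV. v $ i * a $ i) = 0"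
  shows "det_rows p q r s = 0"
  unfolding det_eq_0_iff using assms
  by (intro exI[of _ a]) (simp add: vec_eq_iff matrix_vector_mult_def forall_4 vector_4)

lemma row_nth: "row i M = M $ i"
  by (simp add: row_def vec_eq_iff)

lemma camera_tensor_nth:
  "camera_tensor A B C $ (i, j, k) =
     (-1) ^ (num3 i + num2 j + num2 k) *
     det_rows (A $ fst (others3 i)) (A $ snd (others3 i)) (B $ other2 j) (C $ other2 k)"
  by (simp add: camera_tensor_def det_transpose row_nth split: prod.split)

text \<open>The image points \<open>B a\<close> and \<open>C a\<close> of the centre \<open>a\<close> of the pinhole camera lie in the kernel.\<close>

lemma hyperdet_camera_tensor: "hyperdet (($) (camera_tensor A B C)) = 0"
proof -
  \<comment> \<open>Repeating a row makes the matrix square and singular; a vector in its kernel is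
    a centre of the pinhole camera.\<close>
  have "det_rows (A $ 1) (A $ 2) (A $ 3) (A $ 1) = 0"
    unfolding det_4 vector_4 by (simp add: algebra_simps)
  then obtain a where a: "a \<noteq> 0" "vector [A $ 1, A $ 2, A $ 3, A $ 1] *v a = (0 :: complex^4)"
    unfolding det_eq_0_iff by blast
  have Aa: "(\<Sum>n\<in>UNIV. A $ i $ n * a $ n) = 0" for i
    using a(2) exhaust_3[of i]
    by (auto simp: vec_eq_iff matrix_vector_mult_def forall_4 vector_4)
  have dual: "\<exists>y :: 2 \<Rightarrow> complex. y \<noteq> (\<lambda>j. 0) \<and> (\<Sum>n\<in>UNIV. (y 2 *s M $ 1 - y 1 *s M $ 2) $ n * a $ n) = 0"
    for M :: "complex^4^2"
  proof -
    \<comment> \<open>If \<open>M\<close> annihilates \<open>a\<close>, every \<open>y\<close>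
      satisfies the equation, and the constant 1 is just a nonzero choice.\<close>
    define y where "y = (if M *v a = 0 then (\<lambda>j. 1) else (\<lambda>j. (M *v a) $ j))"
    have "y \<noteq> (\<lambda>j. 0)" by (auto simp: y_def fun_eq_iff vec_eq_iff)
    moreover have "y 2 * (M *v a) $ 1 = y 1 * (M *v a) $ 2" by (simp add: y_def)
    then have "(\<Sum>n\<in>UNIV. (y 2 *s M $ 1 - y 1 *s M $ 2) $ n * a $ n) = 0"
      by (simp add: matrix_vector_mult_def sum_4 algebra_simps)
    ultimately show ?thesis by blast
  qed
  obtain y :: "2 \<Rightarrow> complex" where y: "y \<noteq> (\<lambda>j. 0)" "(\<Sum>n\<in>UNIV. (y 2 *s B $ 1 - y 1 *s B $ 2) $ n * a $ n) = 0"
    using dual by blast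
  obtain z :: "2 \<Rightarrow> complex" where z: "z \<noteq> (\<lambda>j. 0)" "(\<Sum>n\<in>UNIV. (z 2 *s C $ 1 - z 1 *s C $ 2) $ n * a $ n) = 0"
    using dual by blast
  have "kernel (($) (camera_tensor A B C)) (\<lambda>j k. y j * z k)"
    unfolding kernel_def
  proof
    fix i
    let ?d = "det_rows (A $ fst (others3 i)) (A $ snd (others3 i))"
    \<comment> \<open>The signs and complementary indices make the contraction a single determinant,
      by bilinearity in its last two rows. All four rows annihilate \<open>a\<close>.\<close>
    have "(\<Sum>j\<in>UNIV. \<Sum>k\<in>UNIV. camera_tensor A B C $ (i, j, k) * (y j * z k)) =
        (-1) ^ num3 i * ?d (y 2 *s B $ 1 - y 1 *s B $ 2) (z 2 *s C $ 1 - z 1 *s C $ 2)"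
      unfolding det_rows_bilinear camera_tensor_nth
      by (simp add: sum_2 num2_def other2_def power_add algebra_simps)
    also have "\<dots> = 0"
      using det_rows_eq_0[OF a(1)] Aa y(2) z(2) by simp
    finally show "(\<Sum>j\<in>UNIV. \<Sum>k\<in>UNIV. camera_tensor A B C $ (i, j, k) * (y j * z k)) = 0" .
  qed
  then show ?thesis using y(1) z(1) hyperdet_eq_0_iff by blast
qed

section \<open>Reconstructing cameras from a singular tensor\<close>

definition perp :: "(2 \<Rightarrow> 'a::comm_ring_1) \<Rightarrow> 2 \<Rightarrow> 'a" where
  "perp y j = (if j = 1 then - y 2 else y 1)"

lemma orthogonal_multiple_perp:
  fixes y w :: "2 \<Rightarrow> 'a::field"
  assumes "y \<noteq> (\<lambda>j. 0)" "w 1 * y 1 + w 2 * y 2 = 0"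
  obtains b where "\<And>j. w j = b * perp y j"
proof (cases "y 1 = 0")
  case True
  then have y2: "y 2 \<noteq> 0" using assms(1) by (auto simp: fun_eq_iff forall_2)
  have "w j = (- w 1 / y 2) * perp y j" for j
    using exhaust_2[of j] True y2 assms(2) by (auto simp: perp_def)
  then show thesis by (rule that)
next
  case False
  have "w j = (w 2 / y 1) * perp y j" for j
    using exhaust_2[of j] False assms(2) by (auto simp: perp_def field_simps eq_neg_iff_add_eq_0)
  then show thesis by (rule that)
qed

text \<open>Contracting \<open>m\<close> with \<open>y\<close> gives a vector orthogonal to
  \<open>z\<close>, hence a multiple of \<open>perp z\<close>. A vector \<open>p\<close> dual to
  \<open>y\<close> splits this part off, and the rest is a multiple of \<open>perp y\<close> in
  \<open>j\<close>.\<close>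

lemma orthogonal_to_product:
  fixes y z :: "2 \<Rightarrow> 'a::field" and m :: "2 \<Rightarrow> 2 \<Rightarrow> 'a"
  assumes "y \<noteq> (\<lambda>j. 0)" "z \<noteq> (\<lambda>k. 0)" "(\<Sum>j\<in>UNIV. \<Sum>k\<in>UNIV. m j k * (y j * z k)) = 0"
  shows "\<exists>b c. \<forall>j k. m j k = perp y j * c k + b j * perp z k"
proof -
  obtain p :: "2 \<Rightarrow> 'a" where p: "p 1 * y 1 + p 2 * y 2 = 1"
  proof (cases "y 1 = 0")
    case True
    then have "y 2 \<noteq> 0" using assms(1) by (auto simp: fun_eq_iff forall_2)
    then show thesis using that[of "\<lambda>j. if j = 1 then 0 else 1 / y 2"] by simp
  next
    case False
    then show thesis using that[of "\<lambda>j. if j = 1 then 1 / y 1 else 0"] by simp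
  qed
  let ?w = "\<lambda>k. y 1 * m 1 k + y 2 * m 2 k"
  have "?w 1 * z 1 + ?w 2 * z 2 = 0" using assms(3) by (simp add: sum_2 algebra_simps)
  then obtain b where b: "\<And>k. ?w k = b * perp z k"
    using orthogonal_multiple_perp[where y = z and w = ?w] assms(2) by metis
  let ?c = "\<lambda>k. p 1 * m 2 k - p 2 * m 1 k"
  have "m j k = perp y j * ?c k + (p j * b) * perp z k" for j k
  proof -
    have "m j k = (p 1 * y 1 + p 2 * y 2) * m j k" using p by simp
    also have "\<dots> = perp y j * ?c k + p j * ?w k"
      using exhaust_2[of j] by (auto simp: perp_def algebra_simps)
    finally show ?thesis unfolding b by (simp only: mult.assoc)
  qed
  then show ?thesis by (intro exI[of _ "\<lambda>j. p j * b"] exI[of _ ?c] allI)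
qed

text \<open>Placing the centre of the pinhole camera at the last coordinate point and the kernel element
  \<open>y \<otimes> z\<close> in the last columns of \<open>B\<close> and \<open>C\<close>, the remaining entries of \<open>B\<close> and \<open>C\<close>
  can be read off the tensor.\<close>

lemma camera_tensor_exists:
  assumes "hyperdet (($) t) = 0"
  shows "\<exists>A B C. camera_tensor A B C = t"
proof -
  obtain y z where yz: "y \<noteq> (\<lambda>j. 0)" "z \<noteq> (\<lambda>k. 0)" and ker: "kernel (($) t) (\<lambda>j k. y j * z k)"
    using assms hyperdet_eq_0_iff by blast
  have "\<exists>b c. \<forall>j k. t $ (i, j, k) = perp y j * c k + b j * perp z k" for i
    using orthogonal_to_product[OF yz, of "\<lambda>j k. t $ (i, j, k)"] ker unfolding kernel_def by blast
  then obtain b c where bc: "\<And>i j k. t $ (i, j, k) = perp y j * c i k + b i j * perp z k"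
    by metis
  define A :: "complex^4^3" where
    "A = (\<chi> i. if i = 1 then vector [1, 0, 0, 0] else if i = 2 then vector [0, 1, 0, 0] else vector [0, 0, 1, 0])"
  define B :: "complex^4^2" where
    "B = (\<chi> j. if j = 1 then vector [- b 1 2, - b 2 2, - b 3 2, y 1] else vector [b 1 1, b 2 1, b 3 1, y 2])"
  define C :: "complex^4^2" where
    "C = (\<chi> k. if k = 1 then vector [c 1 2, c 2 2, c 3 2, z 1] else vector [- c 1 1, - c 2 1, - c 3 1, z 2])"
  have "\<forall>i j k. camera_tensor A B C $ (i, j, k) = t $ (i, j, k)"
    unfolding forall_3 forall_2 bc camera_tensor_nth det_4 vector_4
    by (simp add: A_def B_def C_def vector_4 num3_def num2_def others3_def other2_def perp_def)
  then have "camera_tensor A B C = t" by (simp add: vec_eq_iff split_paired_all)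
  then show ?thesis by blast
qed

lemma camera_variety_eq: "camera_variety = zero_locus {camera_poly}"
proof -
  have "{vec.span {camera_tensor A B C} | A B C. camera_tensor A B C \<noteq> 0} = zero_locus {camera_poly}"
    unfolding zero_locus_eq[OF homogeneous_camera_poly] eval_camera_poly
    using hyperdet_camera_tensor camera_tensor_exists by blast
  moreover have "zariski_closed (zero_locus {camera_poly})"
    unfolding zariski_closed_def using homogeneous_camera_poly by blast
  ultimately show ?thesis unfolding camera_variety_def by (simp add: hull_same)
qed

section \<open>The vanishing ideal\<close>

text \<open>The degree is only bounded by \<open>d\<close>, so \<open>c\<close> may be 0. Thus sums
  in which leading terms cancel need no special treatment.\<close>

definition leading :: "nat \<Rightarrow> 'a::comm_ring_1 poly \<Rightarrow> 'a \<Rightarrow> bool" where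
  "leading d p c \<longleftrightarrow> degree p \<le> d \<and> coeff p d = c"

lemma leading_add: "leading d p a \<Longrightarrow> leading d q b \<Longrightarrow> leading d (p + q) (a + b)"
  by (auto simp: leading_def intro: degree_add_le)

lemma leading_diff: "leading d p a \<Longrightarrow> leading d q b \<Longrightarrow> leading d (p - q) (a - b)"
  by (auto simp: leading_def intro: degree_diff_le)

lemma leading_uminus: "leading d p a \<Longrightarrow> leading d (- p) (- a)"
  by (auto simp: leading_def)

lemma leading_mult:
  assumes "leading d p a" "leading e q b"
  shows "leading (d + e) (p * q) (a * b)"
proof -
  have d: "degree p \<le> d" "degree q \<le> e" using assms by (auto simp: leading_def)
  have "coeff (p * q) (d + e) = (\<Sum>i\<le>d + e. if i = d then a * b else 0)"
    unfolding coeff_mult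
  proof (rule sum.cong[OF refl])
    fix i assume "i \<in> {..d + e}"
    then show "coeff p i * coeff q (d + e - i) = (if i = d then a * b else 0)"
      using assms d by (cases i d rule: linorder_cases) (auto simp: leading_def coeff_eq_0)
  qed
  moreover have "degree (p * q) \<le> d + e" using degree_mult_le[of p q] d by linarith
  ultimately show ?thesis by (simp add: leading_def)
qed

lemma leading_det_cols:
  assumes "\<And>i. leading 1 (f i) (a i)" "\<And>i. leading 1 (g i) (b i)" "\<And>i. leading 1 (h i) (c i)"
  shows "leading 3 (det_cols f g h) (det_cols a b c)"
proof -
  have "leading (1 + (1 + 1)) (det_cols f g h) (det_cols a b c)"
    unfolding det_cols_def by (intro leading_add leading_diff leading_mult assms)
  then show ?thesis by (simp add: numeral_3_eq_3)
qed

text \<open>The top coefficient of a hyperdeterminant of linear polynomials is the hyperdeterminant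
  of their slopes.\<close>

lemma leading_hyperdet:
  assumes "\<And>p. leading 1 (f p) (g p)"
  shows "leading 6 (hyperdet f) (hyperdet g)"
proof -
  have "leading 3 (minor f j k) (minor g j k)" for j k
    by (auto simp: minor_def simp del: One_nat_def intro!: leading_uminus leading_det_cols assms)
  then have "leading (3 + 3) (hyperdet f) (hyperdet g)"
    unfolding hyperdet_def by (intro leading_diff leading_mult)
  then show ?thesis by simp
qed

text \<open>The direction along which the hyperdeterminant becomes a monic polynomial.\<close>

definition dir :: "tensor_index \<Rightarrow> 'a::comm_ring_1" where
  "dir p = (if p = (1, 1, 2) \<or> p = (2, 2, 1) \<or> p = (3, 1, 1) then 1 else if p = (3, 2, 2) then - 1 else 0)"

lemma hyperdet_dir: "hyperdet dir = 1"
  by (simp add: hyperdet_defs dir_def)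

lemma of_real_dir: "complex_of_real (dir p) = dir p"
  by (simp add: dir_def)

section \<open>Substitution along the direction \<open>dir\<close>\<close>

definition shifted_var :: "tensor_index \<Rightarrow> tensor_index cpoly poly" where
  "shifted_var p = [:var p, dir p:]"

text \<open>This is \<open>G\<close> at \<open>x + s * dir\<close>, as a univariate polynomial in
  \<open>s\<close> whose coefficients are polynomials in \<open>x\<close>. The division by the
  sextic takes place here.\<close>

definition shift :: "tensor_index cpoly \<Rightarrow> tensor_index cpoly poly" where
  "shift G = (\<Sum>m\<in>Poly_Mapping.keys G.
     [:Poly_Mapping.single 0 (Poly_Mapping.lookup G m):] *
     (\<Prod>p\<in>UNIV. shifted_var p ^ Poly_Mapping.lookup m p))"

lemma eval_poly_prod [simp]: "eval_poly (prod F A) x = (\<Prod>a\<in>A. eval_poly (F a) x)"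
  by (induction A rule: infinite_finite_induct) auto

lemma eval_poly_power [simp]: "eval_poly (F ^ n) x = eval_poly F x ^ n"
  by (induction n) auto

lemma eval_poly_const [simp]: "eval_poly (Poly_Mapping.single 0 c) x = c"
  by simp

lemma eval_poly_dir [simp]: "eval_poly (dir p) x = dir p"
  by (simp add: dir_def)

lemma eval_shift:
  "eval_poly (poly (shift G) (Poly_Mapping.single 0 s)) x = eval_poly G (x + s *s (\<chi> p. dir p))"
  by (simp add: shift_def poly_sum poly_prod shifted_var_def eval_poly_def[of G] del: eval_poly_single)

lemma poly_shift_0: "poly (shift G) 0 = G"
proof (rule cpoly_eqI)
  show "eval_poly (poly (shift G) 0) x = eval_poly G x" for x
    using eval_shift[of G 0 x] by simp
qed

lemma poly_hyperdet: "poly (hyperdet f) s = hyperdet (\<lambda>p. poly (f p) s)"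
  by (rule hyperdet_hom[of "\<lambda>q. poly q s"]) auto

lemma poly_hyperdet_shifted_var_0: "poly (hyperdet shifted_var) 0 = camera_poly"
  by (simp add: poly_hyperdet shifted_var_def camera_poly_eq)

lemma eval_hyperdet_shifted_var:
  "eval_poly (poly (hyperdet shifted_var) (Poly_Mapping.single 0 s)) x =
     hyperdet (($) (x + s *s (\<chi> p. dir p)))"
proof -
  have "eval_poly (hyperdet f) x = hyperdet (\<lambda>p. eval_poly (f p) x)" for f
    by (rule hyperdet_hom[of "\<lambda>F. eval_poly F x"]) auto
  moreover have "($) (x + s *s (\<chi> p. dir p)) = (\<lambda>p. x $ p + s * dir p)" by (simp add: fun_eq_iff)
  ultimately show ?thesis
    by (simp add: poly_hyperdet shifted_var_def del: eval_poly_single)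
qed

lemma eval_poly_poly:
  "eval_poly (poly P (Poly_Mapping.single 0 s)) x = poly (map_poly (\<lambda>F. eval_poly F x) P) s"
  by (induction P) (simp_all add: map_poly_pCons del: eval_poly_single)

section \<open>Six real roots on nearby lines\<close>

lemma sign_change_root:
  fixes f :: "real \<Rightarrow> real"
  assumes "continuous_on UNIV f" "a < b" "f a * f b < 0"
  obtains c where "a < c" "c < b" "f c = 0"
proof -
  have cont: "continuous_on {a..b} f" using assms(1) continuous_on_subset by blast
  have "\<exists>c. a \<le> c \<and> c \<le> b \<and> f c = 0"
  proof (cases "f a < 0")
    case True
    then have "f b > 0" using assms(3) by (simp add: mult_less_0_iff)
    then show ?thesis using IVT'[of f a 0 b] True cont assms(2) by auto
  next
    case False
    then have "f a > 0" "f b < 0" using assms(3) by (auto simp: mult_less_0_iff)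
    then show ?thesis using IVT2'[of f b 0 a] cont assms(2) by auto
  qed
  then obtain c where c: "a \<le> c" "c \<le> b" "f c = 0" by blast
  moreover have "c \<noteq> a" "c \<noteq> b" using c assms(3) by auto
  ultimately show thesis using that by force
qed

text \<open>Found by search: along \<open>dir\<close>, the hyperdeterminant changes sign six times on the real line
  through this tensor.\<close>

definition base_tensor :: "real ^ tensor_index" where
  "base_tensor = (\<chi> p. if p = (1, 1, 1) \<or> p = (2, 2, 1) \<or> p = (2, 2, 2) then - 3
     else if p = (3, 1, 2) then - 2 else if p = (3, 2, 1) then 1 else 0)"

definition on_line :: "real ^ tensor_index \<Rightarrow> real \<Rightarrow> real" where
  "on_line x s = hyperdet (\<lambda>p. x $ p + s * dir p)"

lemma on_line_base_tensor:
  "on_line base_tensor (-3) = 405" "on_line base_tensor (-2) = -14" "on_line base_tensor (-1) = 25"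
  "on_line base_tensor 0 = -162" "on_line base_tensor 3 = 81" "on_line base_tensor 4 = -50" "on_line base_tensor 5 = 133"
  by (simp_all add: on_line_def base_tensor_def dir_def hyperdet_defs)

lemma continuous_on_hyperdet [continuous_intros]:
  fixes f :: "'a::topological_space \<Rightarrow> tensor_index \<Rightarrow> real"
  assumes "\<And>p. continuous_on A (\<lambda>x. f x p)"
  shows "continuous_on A (\<lambda>x. hyperdet (f x))"
  by (simp add: hyperdet_defs) (intro continuous_intros assms)

text \<open>The signs at seven nodes persist under small perturbations, and each of the six sign
  changes yields a root by the intermediate value theorem.\<close>

lemma six_roots_near_base_tensor:
  obtains e where "e > 0"
    "\<And>x. (\<And>p. \<bar>x $ p - base_tensor $ p\<bar> < e) \<Longrightarrow> \<exists>Z. finite Z \<and> card Z = 6 \<and> (\<forall>s\<in>Z. on_line x s = 0)"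
proof -
  let ?T = "{-3, -2, -1, 0, 3, 4, 5 :: real}"
  \<comment> \<open>The tensors with the same sign as \<open>base_tensor\<close> at every
    node.\<close>
  let ?U = "\<Inter>s\<in>?T. {x. 0 < on_line base_tensor s * on_line x s}"
  have "open ?U"
    unfolding on_line_def
    by (intro open_INT ballI open_Collect_less continuous_intros) auto
  moreover have "base_tensor \<in> ?U" by (simp add: on_line_base_tensor)
  ultimately obtain d where d: "d > 0" "ball base_tensor d \<subseteq> ?U" by (meson open_contains_ball)
  let ?n = "real CARD(tensor_index)"
  show thesis
  proof (rule that)
    show "d / ?n > 0" using d(1) by simp
    fix x :: "real ^ tensor_index" assume x: "\<And>p. \<bar>x $ p - base_tensor $ p\<bar> < d / ?n"
    have "norm (x - base_tensor) \<le> (\<Sum>p\<in>UNIV. \<bar>(x - base_tensor) $ p\<bar>)" by (rule norm_le_l1_cart)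
    also have "\<dots> < (\<Sum>p\<in>(UNIV :: tensor_index set). d / ?n)"
      using x by (intro sum_strict_mono) auto
    also have "\<dots> = d" by simp
    finally have "x \<in> ?U" using d(2) by (auto simp: dist_norm norm_minus_commute)
    then have sg: "on_line x (-3) > 0" "on_line x (-2) < 0" "on_line x (-1) > 0" "on_line x 0 < 0"
      "on_line x 3 > 0" "on_line x 4 < 0" "on_line x 5 > 0"
      by (simp_all add: on_line_base_tensor zero_less_mult_iff)
    have cont: "continuous_on UNIV (on_line x)"
      unfolding on_line_def by (intro continuous_intros)
    have root: "\<exists>c. a < c \<and> c < b \<and> on_line x c = 0" if "a < b" "on_line x a * on_line x b < 0" for a b
      using sign_change_root[OF cont that] by blast
    obtain r1 where r1: "-3 < r1" "r1 < -2" "on_line x r1 = 0"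
      using root[of "-3" "-2"] sg by (auto simp: mult_less_0_iff)
    obtain r2 where r2: "-2 < r2" "r2 < -1" "on_line x r2 = 0"
      using root[of "-2" "-1"] sg by (auto simp: mult_less_0_iff)
    obtain r3 where r3: "-1 < r3" "r3 < 0" "on_line x r3 = 0"
      using root[of "-1" "0"] sg by (auto simp: mult_less_0_iff)
    obtain r4 where r4: "0 < r4" "r4 < 3" "on_line x r4 = 0"
      using root[of "0" "3"] sg by (auto simp: mult_less_0_iff)
    obtain r5 where r5: "3 < r5" "r5 < 4" "on_line x r5 = 0"
      using root[of "3" "4"] sg by (auto simp: mult_less_0_iff)
    obtain r6 where r6: "4 < r6" "r6 < 5" "on_line x r6 = 0"
      using root[of "4" "5"] sg by (auto simp: mult_less_0_iff)
    have "card {r1, r2, r3, r4, r5, r6} = 6" using r1 r2 r3 r4 r5 r6 by simp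
    then show "\<exists>Z. finite Z \<and> card Z = 6 \<and> (\<forall>s\<in>Z. on_line x s = 0)"
      using r1 r2 r3 r4 r5 r6 by (intro exI[of _ "{r1, r2, r3, r4, r5, r6}"]) simp
  qed
qed

lemma hyperdet_of_real: "hyperdet (\<lambda>p. complex_of_real (f p)) = of_real (hyperdet f)"
  by (rule hyperdet_hom[of of_real, symmetric]) auto

lemma vanishing_imp_dvd:
  assumes zero: "\<And>t. hyperdet (($) t) = 0 \<Longrightarrow> eval_poly G t = 0"
  shows "camera_poly dvd G"
proof -
  define P where "P = hyperdet shifted_var"
  have lead: "leading 6 P 1"
    unfolding P_def hyperdet_dir[symmetric]
    by (intro leading_hyperdet) (simp add: leading_def shifted_var_def)
  then have deg: "degree P = 6" by (metis leading_def antisym le_degree zero_neq_one)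
  have "P \<noteq> 0" using deg by auto
  \<comment> \<open>The coefficients do not form a field, but \<open>P\<close> is monic, so the
    scaling factor of pseudo-division is 1 and this is division with remainder.\<close>
  obtain Q R where QR: "pseudo_divmod (shift G) P = (Q, R)" by fastforce
  have div: "shift G = P * Q + R" and degR: "R = 0 \<or> degree R < 6"
    using pseudo_divmod[OF \<open>P \<noteq> 0\<close> QR] lead deg by (simp_all add: leading_def)
  obtain e where e: "e > 0"
    "\<And>x. (\<And>p. \<bar>x $ p - base_tensor $ p\<bar> < e) \<Longrightarrow> \<exists>Z. finite Z \<and> card Z = 6 \<and> (\<forall>s\<in>Z. on_line x s = 0)"
    using six_roots_near_base_tensor by blast
  let ?S = "\<lambda>p. complex_of_real ` {base_tensor $ p - e <..< base_tensor $ p + e}"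
  have inf: "infinite (?S p)" for p
    using e(1) by (subst finite_image_iff) (auto simp: inj_on_def infinite_Ioo)
  have "coeff R n = 0" for n
  proof (rule poly_eq_0_if_zero_on_box[OF inf])
    fix x assume x: "\<And>p. x $ p \<in> ?S p"
    define y :: "real ^ tensor_index" where "y = (\<chi> p. Re (x $ p))"
    have y: "x $ p = of_real (y $ p)" "\<bar>y $ p - base_tensor $ p\<bar> < e" for p
      using x[of p] by (auto simp: y_def)
    obtain Z where Z: "finite Z" "card Z = 6" "\<forall>s\<in>Z. on_line y s = 0" using e(2) y(2) by blast
    let ?r = "map_poly (\<lambda>F. eval_poly F x) R"
    have root: "poly ?r (of_real s) = 0" if "s \<in> Z" for s
    proof -
      let ?t = "x + of_real s *s (\<chi> p. dir p)"
      have "($) ?t = (\<lambda>p. of_real (y $ p + s * dir p))"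
        by (simp add: fun_eq_iff y(1) of_real_dir)
      then have t: "hyperdet (($) ?t) = 0"
        using Z(3) that by (simp only: hyperdet_of_real) (simp add: on_line_def)
      have "eval_poly (poly (shift G) (Poly_Mapping.single 0 (of_real s))) x =
        eval_poly (poly P (Poly_Mapping.single 0 (of_real s))) x *
        eval_poly (poly Q (Poly_Mapping.single 0 (of_real s))) x + poly ?r (of_real s)"
        unfolding div by (simp add: eval_poly_poly del: eval_poly_single)
      then show ?thesis
        using t zero[OF t] by (simp add: eval_shift P_def eval_hyperdet_shifted_var)
    qed
    \<comment> \<open>Six distinct roots against a degree below 6.\<close>
    have "?r = 0"
    proof (rule ccontr)
      assume "?r \<noteq> 0"
      then have "R \<noteq> 0" by auto
      have "degree ?r \<le> degree R" by (rule map_poly_degree_leq)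
      then have "degree ?r < 6" using degR \<open>R \<noteq> 0\<close> by simp
      have "complex_of_real ` Z \<subseteq> {s. poly ?r s = 0}" using root by auto
      then have "card (complex_of_real ` Z) \<le> card {s. poly ?r s = 0}"
        by (intro card_mono poly_roots_finite \<open>?r \<noteq> 0\<close>)
      also have "card (complex_of_real ` Z) = 6" using Z(2) by (simp add: card_image inj_on_def)
      also have "card {s. poly ?r s = 0} \<le> degree ?r" by (rule card_poly_roots_bound[OF \<open>?r \<noteq> 0\<close>])
      finally show False using \<open>degree ?r < 6\<close> by simp
    qed
    then have "coeff ?r n = 0" by simp
    then show "eval_poly (coeff R n) x = 0" by (simp add: coeff_map_poly)
  qed
  then have "R = 0" by (simp add: poly_eq_iff)
  \<comment> \<open>At \<open>s = 0\<close> the shift disappears: the left side is \<open>G\<close>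
    and \<open>P\<close> becomes the sextic.\<close>
  then have "poly (shift G) 0 = poly P 0 * poly Q 0" by (simp add: div)
  then show ?thesis
    unfolding poly_shift_0 P_def poly_hyperdet_shifted_var_0 by (metis dvd_triv_left)
qed

lemma vanishing_ideal_camera:
  "vanishing_ideal (zero_locus {camera_poly}) = {G. camera_poly dvd G}"
proof (intro set_eqI iffI)
  fix G assume "G \<in> vanishing_ideal (zero_locus {camera_poly})"
  then have *: "eval_poly G x = 0" if "L \<in> zero_locus {camera_poly}" "x \<in> L" for L x
    using that by (auto simp: vanishing_ideal_def)
  have nz: "eval_poly G t = 0" if "hyperdet (($) t) = 0" "t \<noteq> 0" for t
    using that *[of "vec.span {t}" t] span_mem_zero_locus_iff[OF homogeneous_camera_poly]
    by (simp add: eval_camera_poly vec.span_base)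
  \<comment> \<open>The origin is not a projective point but lies on every line, so any point of the
    hypersurface forces vanishing there.\<close>
  have "eval_poly G 0 = 0"
  proof -
    let ?t = "(\<chi> p. if p = (1, 1, 1) then 1 else 0) :: tensor322"
    have t: "hyperdet (($) ?t) = 0" by (simp add: hyperdet_defs)
    have "?t $ (1, 1, 1) \<noteq> 0" by simp
    then have "?t \<noteq> 0" by (metis zero_index)
    then have "vec.span {?t} \<in> zero_locus {camera_poly}"
      using t span_mem_zero_locus_iff[OF homogeneous_camera_poly] eval_camera_poly by metis
    then show ?thesis using * vec.span_zero by blast
  qed
  then show "G \<in> {G. camera_poly dvd G}" using vanishing_imp_dvd nz by blast
next
  fix G assume "G \<in> {G. camera_poly dvd G}"
  then show "G \<in> vanishing_ideal (zero_locus {camera_poly})"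
    by (auto simp: vanishing_ideal_def zero_locus_def elim!: dvdE)
qed

section \<open>The group action\<close>

definition act1 :: "complex^3^3 \<Rightarrow> tensor322 \<Rightarrow> tensor322" where
  "act1 g t = (\<chi> p. case p of (i, j, k) \<Rightarrow> \<Sum>a\<in>UNIV. g $ i $ a * t $ (a, j, k))"

definition act2 :: "complex^2^2 \<Rightarrow> tensor322 \<Rightarrow> tensor322" where
  "act2 h t = (\<chi> p. case p of (i, j, k) \<Rightarrow> \<Sum>b\<in>UNIV. h $ j $ b * t $ (i, b, k))"

definition act3 :: "complex^2^2 \<Rightarrow> tensor322 \<Rightarrow> tensor322" where
  "act3 h t = (\<chi> p. case p of (i, j, k) \<Rightarrow> \<Sum>c\<in>UNIV. h $ k $ c * t $ (i, j, c))"

lemma act_nth [simp]: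
  "act1 g t $ (i, j, k) = (\<Sum>a\<in>UNIV. g $ i $ a * t $ (a, j, k))"
  "act2 h t $ (i, j, k) = (\<Sum>b\<in>UNIV. h $ j $ b * t $ (i, b, k))"
  "act3 h t $ (i, j, k) = (\<Sum>c\<in>UNIV. h $ k $ c * t $ (i, j, c))"
  by (simp_all add: act1_def act2_def act3_def)

lemma tensor_eqI: "(\<And>i j k. s $ (i, j, k) = t $ (i, j, k)) \<Longrightarrow> s = (t :: tensor322)"
  by (simp add: vec_eq_iff split_paired_all)

lemma sl_act_eq: "sl_act g h k t = act1 g (act2 h (act3 k t))"
  by (rule tensor_eqI) (simp add: sl_act_def sum_distrib_left mult.assoc)

lemma sum_matrix_mult:
  fixes A B :: "'a::comm_ring_1^'n^'n"
  shows "(\<Sum>a\<in>UNIV. A $ i $ a * (\<Sum>b\<in>UNIV. B $ a $ b * f b)) = (\<Sum>b\<in>UNIV. (A ** B) $ i $ b * f b)"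
proof -
  have "A *v (B *v (\<chi> b. f b)) = (A ** B) *v (\<chi> b. f b)"
    by (rule matrix_vector_mul_assoc)
  then show ?thesis by (simp add: matrix_vector_mult_def vec_eq_iff)
qed

lemma act_mult:
  "act1 g (act1 g' t) = act1 (g ** g') t"
  "act2 h (act2 h' t) = act2 (h ** h') t"
  "act3 h (act3 h' t) = act3 (h ** h') t"
  by (rule tensor_eqI, simp add: sum_matrix_mult)+

lemma act_commute:
  "act2 h (act1 g t) = act1 g (act2 h t)"
  "act3 k (act1 g t) = act1 g (act3 k t)"
  "act3 k (act2 h t) = act2 h (act3 k t)"
  by (rule tensor_eqI, simp add: sum_2 sum_3 algebra_simps)+

lemma sum_mat_1: "(\<Sum>a\<in>UNIV. (mat 1 :: 'a::comm_ring_1^'n^'n) $ i $ a * f a) = f i"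
  by (simp add: mat_def if_distrib[of "\<lambda>x. x * _"] cong: if_cong)

lemma act_mat_1 [simp]: "act1 (mat 1) t = t" "act2 (mat 1) t = t" "act3 (mat 1) t = t"
  by (rule tensor_eqI, simp add: sum_mat_1)+

lemma act_scale:
  "act1 (\<chi> i j. c * g $ i $ j) t = c *s act1 g t"
  "act2 (\<chi> i j. c * h $ i $ j) t = c *s act2 h t"
  "act3 (\<chi> i j. c * h $ i $ j) t = c *s act3 h t"
  by (rule tensor_eqI, simp add: sum_distrib_left mult.assoc)+

lemma act_smult:
  "act1 g (c *s t) = c *s act1 g t" "act2 h (c *s t) = c *s act2 h t" "act3 h (c *s t) = c *s act3 h t"
  by (rule tensor_eqI, simp add: sum_distrib_left mult.left_commute)+

lemma act_0 [simp]: "act1 g 0 = 0" "act2 h 0 = 0" "act3 h 0 = 0"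
  by (rule tensor_eqI, simp)+

lemma inverse_matrix:
  fixes M :: "'a::field^'n^'n"
  assumes "det M \<noteq> 0"
  obtains N where "M ** N = mat 1" "N ** M = mat 1" "det N \<noteq> 0"
proof -
  obtain N where N: "M ** N = mat 1" "N ** M = mat 1"
    using assms invertible_det_nz[of M] unfolding invertible_def by blast
  then have "det M * det N = 1" by (metis det_mul det_I)
  then show thesis using that N by force
qed

lemma unimodular_inverse:
  fixes M :: "'a::field^'n^'n"
  assumes "det M = 1"
  obtains N where "det N = 1" "M ** N = mat 1" "N ** M = mat 1"
proof -
  obtain N where N: "M ** N = mat 1" "N ** M = mat 1" using inverse_matrix[of M] assms by auto
  then have "det N = 1" using assms by (metis det_mul det_I mult_1)
  then show thesis using that N by blast
qed

section \<open>From unimodular to invertible matrices\<close>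

lemma root_exists:
  fixes z :: complex
  assumes "n > 0"
  obtains c where "c ^ n = z"
proof -
  let ?p = "monom 1 n - [:z:]"
  have "coeff ?p n = 1" using assms by (simp add: coeff_pCons split: nat.split)
  then have "degree ?p \<noteq> 0" using assms
    by (metis coeff_eq_0 le_degree le_zero_eq less_irrefl zero_neq_one)
  then have "\<not> constant (poly ?p)" by (simp add: constant_degree)
  then obtain c where "poly ?p c = 0" using fundamental_theorem_of_algebra by blast
  then show thesis using that by (simp add: poly_monom)
qed

lemma normalize_det:
  fixes M :: "complex^'n^'n"
  assumes "det M \<noteq> 0"
  obtains c N where "M = (\<chi> i j. c * N $ i $ j)" "det N = 1"
proof -
  obtain c where c: "c ^ CARD('n) = det M" using root_exists[of "CARD('n)"] by auto
  with assms have "c \<noteq> 0" by (auto simp: power_0_left)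
  let ?N = "\<chi> i j. M $ i $ j / c"
  have M: "M = (\<chi> i. c *s ?N $ i)" using \<open>c \<noteq> 0\<close> by (simp add: vec_eq_iff)
  have "det M = c ^ CARD('n) * det ?N" by (subst M, subst det_rows_mul) simp
  then have "det ?N = 1" using c assms by simp
  then show thesis using M by (intro that[of c ?N]) (auto simp: vec_eq_iff)
qed

lemma SL_invariant_zero_locus:
  assumes hom: "homogeneous d F" and inv: "SL_invariant (zero_locus {F})"
    and zero: "eval_poly F t = 0" and det: "det g = 1" "det h = 1" "det k = 1"
  shows "eval_poly F (sl_act g h k t) = 0"
proof (cases "t = 0")
  case True
  then show ?thesis using zero by (simp add: sl_act_eq)
next
  case False
  then have "vec.span {t} \<in> zero_locus {F}" using zero span_mem_zero_locus_iff[OF hom] by blast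
  then have "sl_act g h k ` vec.span {t} \<in> zero_locus {F}"
    using inv det unfolding SL_invariant_def by blast
  moreover have "sl_act g h k t \<in> sl_act g h k ` vec.span {t}" by (simp add: vec.span_base)
  ultimately show ?thesis by (auto simp: zero_locus_def)
qed

text \<open>An invertible complex matrix is a scalar times a unimodular one, and the scalar only
  multiplies the value of the form \<open>F\<close> by a power.\<close>

lemma GL_invariant_zero:
  assumes hom: "homogeneous d F" and inv: "SL_invariant (zero_locus {F})"
    and zero: "eval_poly F t = 0"
  shows "det g \<noteq> 0 \<Longrightarrow> eval_poly F (act1 g t) = 0"
    and "det h \<noteq> 0 \<Longrightarrow> eval_poly F (act2 h t) = 0"
    and "det h \<noteq> 0 \<Longrightarrow> eval_poly F (act3 h t) = 0"
proof -
  note sl = SL_invariant_zero_locus[OF hom inv zero, unfolded sl_act_eq]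
  show "eval_poly F (act1 g t) = 0" if nz: "det g \<noteq> 0"
  proof -
    obtain c g' where g: "g = (\<chi> i j. c * g' $ i $ j)" "det g' = 1" using normalize_det[OF nz] .
    show ?thesis
      using sl[OF g(2) det_I det_I] by (simp add: g(1) act_scale eval_poly_homogeneous[OF hom])
  qed
  show "eval_poly F (act2 h t) = 0" if nz: "det h \<noteq> 0"
  proof -
    obtain c h' where h: "h = (\<chi> i j. c * h' $ i $ j)" "det h' = 1" using normalize_det[OF nz] .
    show ?thesis
      using sl[OF det_I h(2) det_I] by (simp add: h(1) act_scale eval_poly_homogeneous[OF hom])
  qed
  show "eval_poly F (act3 h t) = 0" if nz: "det h \<noteq> 0"
  proof -
    obtain c h' where h: "h = (\<chi> i j. c * h' $ i $ j)" "det h' = 1" using normalize_det[OF nz] .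
    show ?thesis
      using sl[OF det_I det_I h(2)] by (simp add: h(1) act_scale eval_poly_homogeneous[OF hom])
  qed
qed

lemma GL_invariant_zero_iff:
  assumes "homogeneous d F" "SL_invariant (zero_locus {F})"
  shows "det g \<noteq> 0 \<Longrightarrow> eval_poly F (act1 g t) = 0 \<longleftrightarrow> eval_poly F t = 0"
    and "det h \<noteq> 0 \<Longrightarrow> eval_poly F (act2 h t) = 0 \<longleftrightarrow> eval_poly F t = 0"
    and "det h \<noteq> 0 \<Longrightarrow> eval_poly F (act3 h t) = 0 \<longleftrightarrow> eval_poly F t = 0"
  by (metis GL_invariant_zero[OF assms] inverse_matrix act_mult act_mat_1)+

text \<open>By the kernel criterion: \<open>act1\<close> keeps a rank one kernel element, while
  \<open>act2\<close> and \<open>act3\<close> change one of its factors by the inverse transpose,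
  which keeps it nonzero.\<close>

lemma hyperdet_act:
  assumes "hyperdet (($) t) = 0"
  shows "hyperdet (($) (act1 g t)) = 0"
    and "det h \<noteq> 0 \<Longrightarrow> hyperdet (($) (act2 h t)) = 0"
    and "det h \<noteq> 0 \<Longrightarrow> hyperdet (($) (act3 h t)) = 0"
proof -
  obtain y z where yz: "y \<noteq> (\<lambda>j. 0)" "z \<noteq> (\<lambda>k. 0)" and ker: "kernel (($) t) (\<lambda>j k. y j * z k)"
    using assms hyperdet_eq_0_iff by blast
  have ker': "(\<Sum>j\<in>UNIV. \<Sum>k\<in>UNIV. t $ (i, j, k) * (y j * z k)) = 0" for i
    using ker by (simp add: kernel_def)
  have "kernel (($) (act1 g t)) (\<lambda>j k. y j * z k)"
    unfolding kernel_def
  proof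
    fix i
    have "(\<Sum>j\<in>UNIV. \<Sum>k\<in>UNIV. act1 g t $ (i, j, k) * (y j * z k)) =
      (\<Sum>a\<in>UNIV. g $ i $ a * (\<Sum>j\<in>UNIV. \<Sum>k\<in>UNIV. t $ (a, j, k) * (y j * z k)))"
      by (simp add: sum_2 sum_3 algebra_simps)
    then show "(\<Sum>j\<in>UNIV. \<Sum>k\<in>UNIV. act1 g t $ (i, j, k) * (y j * z k)) = 0"
      by (simp add: ker')
  qed
  then show "hyperdet (($) (act1 g t)) = 0" using yz hyperdet_eq_0_iff by blast
  have dual: "\<exists>u. u \<noteq> (\<lambda>j. 0) \<and> (\<forall>b. y b = (\<Sum>j\<in>UNIV. h $ j $ b * u j))"
    if "det h \<noteq> 0" "y \<noteq> (\<lambda>j. 0)" for h :: "complex^2^2" and y :: "2 \<Rightarrow> complex"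
  proof -
    have "det (transpose h) \<noteq> 0" using that(1) by (simp add: det_transpose)
    then obtain N where "transpose h ** N = mat 1" using inverse_matrix by blast
    then have "transpose h *v (N *v (\<chi> b. y b)) = (\<chi> b. y b)"
      by (simp add: matrix_vector_mul_assoc)
    then have *: "y b = (\<Sum>j\<in>UNIV. h $ j $ b * (N *v (\<chi> b. y b)) $ j)" for b
      by (simp add: vec_eq_iff matrix_vector_mult_def transpose_def)
    moreover have "(\<lambda>j. (N *v (\<chi> b. y b)) $ j) \<noteq> (\<lambda>j. 0)"
    proof
      assume "(\<lambda>j. (N *v (\<chi> b. y b)) $ j) = (\<lambda>j. 0)"
      then have "(N *v (\<chi> b. y b)) $ j = 0" for j by meson
      then have "y b = 0" for b by (subst *) simp
      then show False using that(2) by auto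
    qed
    ultimately show ?thesis by blast
  qed
  show "hyperdet (($) (act2 h t)) = 0" if nz: "det h \<noteq> 0"
  proof -
    obtain u where u: "u \<noteq> (\<lambda>j. 0)" "\<And>b. y b = (\<Sum>j\<in>UNIV. h $ j $ b * u j)"
      using dual[OF nz yz(1)] by blast
    have "kernel (($) (act2 h t)) (\<lambda>j k. u j * z k)"
      using ker' unfolding kernel_def by (simp add: u(2) sum_2 algebra_simps)
    then show ?thesis using u(1) yz(2) hyperdet_eq_0_iff by blast
  qed
  show "hyperdet (($) (act3 h t)) = 0" if nz: "det h \<noteq> 0"
  proof -
    obtain u where u: "u \<noteq> (\<lambda>j. 0)" "\<And>b. z b = (\<Sum>j\<in>UNIV. h $ j $ b * u j)"
      using dual[OF nz yz(2)] by blast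
    have "kernel (($) (act3 h t)) (\<lambda>j k. y j * u k)"
      using ker' unfolding kernel_def by (simp add: u(2) sum_2 algebra_simps)
    then show ?thesis using u(1) yz(1) hyperdet_eq_0_iff by blast
  qed
qed

lemma sl_act_inverse:
  assumes "det g = 1" "det h = 1" "det k = 1"
  obtains g' h' k' where "det g' = 1" "det h' = 1" "det k' = 1"
    "\<And>t. sl_act g h k (sl_act g' h' k' t) = t" "\<And>t. sl_act g' h' k' (sl_act g h k t) = t"
proof -
  obtain g' where g: "det g' = 1" "g ** g' = mat 1" "g' ** g = mat 1"
    using unimodular_inverse[OF assms(1)] .
  obtain h' where h: "det h' = 1" "h ** h' = mat 1" "h' ** h = mat 1"
    using unimodular_inverse[OF assms(2)] .
  obtain k' where k: "det k' = 1" "k ** k' = mat 1" "k' ** k = mat 1"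
    using unimodular_inverse[OF assms(3)] .
  show thesis
    using g(1) h(1) k(1)
    by (rule that) (simp_all add: sl_act_eq act_commute act_mult g h k)
qed

lemma SL_invariant_camera_variety: "SL_invariant camera_variety"
proof -
  let ?Y = "{vec.span {x} | x :: tensor322. x \<noteq> 0 \<and> hyperdet (($) x) = 0}"
  have Y: "camera_variety = ?Y"
    by (simp add: camera_variety_eq zero_locus_eq[OF homogeneous_camera_poly] eval_camera_poly)
  have image: "sl_act g h k ` L \<in> ?Y" if d: "det g = 1" "det h = 1" "det k = 1" and L: "L \<in> ?Y" for g h k L
  proof -
    obtain x where x: "x \<noteq> 0" "hyperdet (($) x) = 0" "L = vec.span {x}" using L by blast
    obtain g' h' k' where "\<And>t. sl_act g' h' k' (sl_act g h k t) = t" using sl_act_inverse[OF d] by metis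
    then have "sl_act g' h' k' (sl_act g h k x) = x" .
    then have "sl_act g h k x \<noteq> 0" using x(1) by (auto simp: sl_act_eq)
    moreover have "hyperdet (($) (sl_act g h k x)) = 0"
      using d x(2) by (simp add: sl_act_eq hyperdet_act)
    moreover have "sl_act g h k ` L = vec.span {sl_act g h k x}"
      unfolding x(3) vec.span_singleton by (simp add: image_image sl_act_eq act_smult)
    ultimately show ?thesis by blast
  qed
  have "(\<lambda>L. sl_act g h k ` L) ` ?Y = ?Y" if d: "det g = 1" "det h = 1" "det k = 1" for g h k
  proof
    show "(\<lambda>L. sl_act g h k ` L) ` ?Y \<subseteq> ?Y" using image[OF d] by blast
    obtain g' h' k' where *: "det g' = 1" "det h' = 1" "det k' = 1"
      "\<And>t. sl_act g h k (sl_act g' h' k' t) = t" using sl_act_inverse[OF d] by metis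
    \<comment> \<open>This is the first inclusion applied to the inverse group element.\<close>
    show "?Y \<subseteq> (\<lambda>L. sl_act g h k ` L) ` ?Y"
    proof
      fix L assume "L \<in> ?Y"
      then have "sl_act g' h' k' ` L \<in> ?Y" by (rule image[OF *(1-3)])
      moreover have "L = sl_act g h k ` (sl_act g' h' k' ` L)" by (simp add: image_image *(4))
      ultimately show "L \<in> (\<lambda>L. sl_act g h k ` L) ` ?Y" by (rule rev_image_eqI)
    qed
  qed
  then show ?thesis unfolding SL_invariant_def Y by simp
qed

section \<open>Orbits and uniqueness\<close>

text \<open>A vector orthogonal to all columns is orthogonal to three independent ones.\<close>

lemma rank_three_minor:
  fixes f :: "tensor_index \<Rightarrow> 'a::field"
  assumes "minor f j k \<noteq> 0"
  shows "rank_three f"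
  unfolding rank_three_def
proof (intro allI impI)
  fix x :: "3 \<Rightarrow> 'a" assume x: "\<forall>j k. (\<Sum>i\<in>UNIV. x i * f (i, j, k)) = 0"
  have *: "x = (\<lambda>i. 0)" if "det_cols (\<lambda>i. f (i, p)) (\<lambda>i. f (i, q)) (\<lambda>i. f (i, r)) \<noteq> 0" for p q r
  proof (rule ccontr)
    assume "x \<noteq> (\<lambda>i. 0)"
    let ?M = "\<chi> i j. if j = 1 then f (i, p) else if j = 2 then f (i, q) else f (i, r) :: 'a^3^3"
    have "(\<chi> i. x i) \<noteq> 0" using \<open>x \<noteq> (\<lambda>i. 0)\<close> by (auto simp: vec_eq_iff)
    moreover have "transpose ?M *v (\<chi> i. x i) = 0"
      using x by (cases p; cases q; cases r)
        (simp add: vec_eq_iff matrix_vector_mult_def transpose_def mult.commute forall_3)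
    ultimately have "det ?M = 0" using det_eq_0_iff[of "transpose ?M"] by (auto simp: det_transpose)
    then show False using that by (simp add: det_cols_eq_det)
  qed
  show "x = (\<lambda>i. 0)"
    using assms * by (auto simp: minor_def split: if_splits)
qed

lemma rank_three_hyperdet:
  fixes f :: "tensor_index \<Rightarrow> 'a::field"
  assumes "hyperdet f \<noteq> 0"
  shows "rank_three f"
proof -
  have "minor f 1 1 \<noteq> 0 \<or> minor f 1 2 \<noteq> 0" using assms by (auto simp: hyperdet_def)
  then show ?thesis using rank_three_minor by blast
qed

lemma rank_three_act:
  assumes "rank_three (($) t)" and det: "det h \<noteq> 0"
  shows "rank_three (($) (act2 h t))" "rank_three (($) (act3 h t))"
proof -
  have inj: "w b = 0" if "\<And>j. (\<Sum>b\<in>UNIV. h $ j $ b * w b) = 0" for w b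
  proof -
    have "h *v (\<chi> b. w b) = 0" using that by (simp add: vec_eq_iff matrix_vector_mult_def)
    then have "(\<chi> b. w b) = 0" using det det_eq_0_iff by blast
    then show ?thesis by (simp add: vec_eq_iff)
  qed
  show "rank_three (($) (act2 h t))"
    unfolding rank_three_def
  proof (intro allI impI)
    fix x assume x: "\<forall>j k. (\<Sum>i\<in>UNIV. x i * act2 h t $ (i, j, k)) = 0"
    have "(\<Sum>i\<in>UNIV. x i * t $ (i, b, k)) = 0" for b k
    proof (rule inj[where w = "\<lambda>b. \<Sum>i\<in>UNIV. x i * t $ (i, b, k)"])
      fix j
      have "(\<Sum>b\<in>UNIV. h $ j $ b * (\<Sum>i\<in>UNIV. x i * t $ (i, b, k))) =
          (\<Sum>i\<in>UNIV. x i * act2 h t $ (i, j, k))"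
        by (simp add: sum_2 sum_3 algebra_simps)
      then show "(\<Sum>b\<in>UNIV. h $ j $ b * (\<Sum>i\<in>UNIV. x i * t $ (i, b, k))) = 0" using x by simp
    qed
    then show "x = (\<lambda>i. 0)" using assms(1) unfolding rank_three_def by blast
  qed
  show "rank_three (($) (act3 h t))"
    unfolding rank_three_def
  proof (intro allI impI)
    fix x assume x: "\<forall>j k. (\<Sum>i\<in>UNIV. x i * act3 h t $ (i, j, k)) = 0"
    have "(\<Sum>i\<in>UNIV. x i * t $ (i, j, c)) = 0" for j c
    proof (rule inj[where w = "\<lambda>c. \<Sum>i\<in>UNIV. x i * t $ (i, j, c)"])
      fix k
      have "(\<Sum>c\<in>UNIV. h $ k $ c * (\<Sum>i\<in>UNIV. x i * t $ (i, j, c))) =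
          (\<Sum>i\<in>UNIV. x i * act3 h t $ (i, j, k))"
        by (simp add: sum_2 sum_3 algebra_simps)
      then show "(\<Sum>c\<in>UNIV. h $ k $ c * (\<Sum>i\<in>UNIV. x i * t $ (i, j, c))) = 0" using x by simp
    qed
    then show "x = (\<lambda>i. 0)" using assms(1) unfolding rank_three_def by blast
  qed
qed

section \<open>Normal forms under the group\<close>

definition columns :: "tensor322 \<Rightarrow> 2 \<times> 2 \<Rightarrow> 2 \<times> 2 \<Rightarrow> 2 \<times> 2 \<Rightarrow> complex^3^3" where
  "columns t p q r = (\<chi> i a. if a = 1 then t $ (i, p) else if a = 2 then t $ (i, q) else t $ (i, r))"

text \<open>The second hypothesis says dually that the three columns span all columns; in rank three
  they then form a basis.\<close>

lemma det_columns:
  assumes "rank_three (($) t)"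
    and "\<And>x j k. (\<Sum>i\<in>UNIV. x i * t $ (i, p)) = 0 \<Longrightarrow> (\<Sum>i\<in>UNIV. x i * t $ (i, q)) = 0 \<Longrightarrow>
      (\<Sum>i\<in>UNIV. x i * t $ (i, r)) = 0 \<Longrightarrow> (\<Sum>i\<in>UNIV. x i * t $ (i, j, k)) = 0"
  shows "det (columns t p q r) \<noteq> 0"
proof
  assume "det (columns t p q r) = 0"
  then obtain x where x: "x \<noteq> 0" "transpose (columns t p q r) *v x = 0"
    using det_eq_0_iff[of "transpose (columns t p q r)"] by (auto simp: det_transpose)
  have *: "(transpose (columns t p q r) *v x) $ a = 0" for a using x(2) by simp
  have "(\<Sum>i\<in>UNIV. x $ i * t $ (i, j, k)) = 0" for j k
    using *[of 1] *[of 2] *[of 3]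
    by (intro assms(2)) (simp_all add: matrix_vector_mult_def transpose_def columns_def mult.commute)
  then have "($) x = (\<lambda>i. 0)" using assms(1) unfolding rank_three_def by blast
  then show False using x(1) by (simp add: vec_eq_iff fun_eq_iff)
qed

text \<open>Representatives of the two orbits of tensors whose flattening has rank 3: its kernel is
  spanned by a matrix of rank two and of rank one, respectively.\<close>

definition generic_tensor :: tensor322 where
  "generic_tensor = (\<chi> p. if p \<in> {(1, 1, 1), (2, 1, 2), (3, 2, 1)} then 1
     else if p = (1, 2, 2) then - 1 else 0)"

definition special_tensor :: tensor322 where
  "special_tensor = (\<chi> p. if p \<in> {(1, 1, 2), (2, 2, 1), (3, 2, 2)} then 1 else 0)"

text \<open>Acting by the transposed matrix of minors turns the kernel element into the identity
  matrix. Then column 22 is the negative of column 11, and the columns 11, 12, 21 are those of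
  \<open>g\<close>.\<close>

lemma generic_orbit:
  assumes "hyperdet (($) t) \<noteq> 0"
  obtains g h where "det g \<noteq> 0" "det h \<noteq> 0" "act2 h t = act1 g generic_tensor"
proof -
  define h :: "complex^2^2" where "h = (\<chi> j b. minor (($) t) b j)"
  have h: "det h \<noteq> 0" using assms by (simp add: h_def det_2 hyperdet_def mult.commute)
  have r: "rank_three (($) (act2 h t))" using rank_three_act[OF rank_three_hyperdet[OF assms] h] by blast
  have "act2 h t $ (i, 1, 1) + act2 h t $ (i, 2, 2) = 0" for i
    using kernel_minor[of "($) t"] by (simp add: kernel_def sum_2 h_def algebra_simps)
  then have col: "act2 h t $ (i, 2, 2) = - act2 h t $ (i, 1, 1)" for i
    by (metis add.commute eq_neg_iff_add_eq_0)
  let ?g = "columns (act2 h t) (1, 1) (1, 2) (2, 1)"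
  have "det ?g \<noteq> 0"
  proof (rule det_columns[OF r])
    fix x :: "3 \<Rightarrow> complex" and j k
    assume *: "(\<Sum>i\<in>UNIV. x i * act2 h t $ (i, 1, 1)) = 0" "(\<Sum>i\<in>UNIV. x i * act2 h t $ (i, 1, 2)) = 0"
      "(\<Sum>i\<in>UNIV. x i * act2 h t $ (i, 2, 1)) = 0"
    have "(\<Sum>i\<in>UNIV. x i * act2 h t $ (i, 2, 2)) = 0"
      using *(1) unfolding col by (simp add: sum_negf del: act_nth)
    then show "(\<Sum>i\<in>UNIV. x i * act2 h t $ (i, j, k)) = 0"
      using * exhaust_2[of j] exhaust_2[of k] by (auto simp del: act_nth)
  qed
  moreover have "\<forall>i j k. act2 h t $ (i, j, k) = act1 ?g generic_tensor $ (i, j, k)"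
    unfolding forall_2 using col
    by (simp add: columns_def generic_tensor_def sum_3 del: act_nth(2))
  then have "act2 h t = act1 ?g generic_tensor" by (intro tensor_eqI) blast
  ultimately show thesis using that h by blast
qed

lemma matrix_with_first_row:
  fixes y :: "2 \<Rightarrow> complex"
  assumes "y \<noteq> (\<lambda>j. 0)"
  obtains h :: "complex^2^2" where "det h \<noteq> 0" "\<And>b. h $ 1 $ b = y b"
proof (cases "y 1 = 0")
  case True
  then have "y 2 \<noteq> 0" using assms by (auto simp: fun_eq_iff forall_2)
  then show thesis
    using that[of "\<chi> j b. if j = 1 then y b else if b = 1 then 1 else 0"] by (simp add: det_2)
next
  case False
  then show thesis
    using that[of "\<chi> j b. if j = 1 then y b else if b = 1 then 0 else 1"] by (simp add: det_2)
qed

text \<open>Taking \<open>y\<close> and \<open>z\<close> as first rows of \<open>h\<close> and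
  \<open>k\<close> makes column 11 vanish; the other three columns form \<open>g\<close>, which is
  singular when the rank drops.\<close>

lemma special_orbit:
  assumes "hyperdet (($) t) = 0"
  obtains g h k where "det h \<noteq> 0" "det k \<noteq> 0" "act3 k (act2 h t) = act1 g special_tensor"
    "rank_three (($) t) \<Longrightarrow> det g \<noteq> 0"
proof -
  obtain y z where yz: "y \<noteq> (\<lambda>j. 0)" "z \<noteq> (\<lambda>k. 0)" and ker: "kernel (($) t) (\<lambda>j k. y j * z k)"
    using assms hyperdet_eq_0_iff by blast
  obtain h :: "complex^2^2" where h: "det h \<noteq> 0" "\<And>b. h $ 1 $ b = y b" using matrix_with_first_row[OF yz(1)] by blast
  obtain k :: "complex^2^2" where k: "det k \<noteq> 0" "\<And>b. k $ 1 $ b = z b" using matrix_with_first_row[OF yz(2)] by blast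
  let ?t = "act3 k (act2 h t)"
  have col: "?t $ (i, 1, 1) = 0" for i
    using ker by (simp add: kernel_def sum_2 h(2) k(2) algebra_simps)
  let ?g = "columns ?t (1, 2) (2, 1) (2, 2)"
  have "det ?g \<noteq> 0" if "rank_three (($) t)"
  proof (rule det_columns)
    show "rank_three (($) ?t)" using rank_three_act that h(1) k(1) by blast
    fix x :: "3 \<Rightarrow> complex" and j k'
    assume *: "(\<Sum>i\<in>UNIV. x i * ?t $ (i, 1, 2)) = 0" "(\<Sum>i\<in>UNIV. x i * ?t $ (i, 2, 1)) = 0"
      "(\<Sum>i\<in>UNIV. x i * ?t $ (i, 2, 2)) = 0"
    moreover have "(\<Sum>i\<in>UNIV. x i * ?t $ (i, 1, 1)) = 0" unfolding col by simp
    ultimately show "(\<Sum>i\<in>UNIV. x i * ?t $ (i, j, k')) = 0"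
      using exhaust_2[of j] exhaust_2[of k'] by (auto simp del: act_nth)
  qed
  moreover have "\<forall>i j k'. ?t $ (i, j, k') = act1 ?g special_tensor $ (i, j, k')"
    unfolding forall_2 using col
    by (simp add: columns_def special_tensor_def sum_3 del: act_nth(2,3))
  then have "?t = act1 ?g special_tensor" by (intro tensor_eqI) blast
  ultimately show thesis using that h(1) k(1) by blast
qed

section \<open>Density along lines\<close>

text \<open>A characteristic polynomial up to sign conventions: only finitely many shifts by scalar
  matrices are singular.\<close>

lemma singular_shifts:
  fixes M :: "complex^3^3"
  obtains q where "q \<noteq> 0" "\<And>s. poly q s = det (M + (\<chi> i j. if i = j then s else 0))"
proof -
  let ?c = "\<lambda>j i. [:M $ i $ j, if i = j then 1 else 0:]"
  let ?q = "det_cols (?c 1) (?c 2) (?c 3)"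
  have "leading 3 ?q (det_cols (\<lambda>i. if i = 1 then 1 else 0) (\<lambda>i. if i = 2 then 1 else 0)
      (\<lambda>i. if i = 3 then 1 else 0))"
    by (rule leading_det_cols) (simp_all add: leading_def)
  then have "coeff ?q 3 = 1" by (simp add: leading_def det_cols_def)
  then have "?q \<noteq> 0" by auto
  moreover have "poly ?q s = det (M + (\<chi> i j. if i = j then s else 0))" for s
    by (simp add: det_cols_def det_3 algebra_simps)
  ultimately show thesis by (rule that)
qed

text \<open>The product of \<open>q\<close> with the restriction of \<open>F\<close> vanishes
  everywhere, and \<open>q\<close> is not the zero polynomial.\<close>

lemma eval_poly_line_eq_0:
  assumes "q \<noteq> 0" "\<And>s. poly q s \<noteq> 0 \<Longrightarrow> eval_poly F (x + s *s y) = 0"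
  shows "eval_poly F (x + s *s y) = 0"
proof -
  obtain p where p: "\<And>s. poly p s = eval_poly F (x + s *s y)" using eval_poly_line by blast
  have "poly (p * q) s = 0" for s using assms(2) p by auto
  then have "p * q = 0" using poly_all_0_iff_0 by blast
  then show ?thesis using assms(1) p[of s] by simp
qed

text \<open>Even if \<open>g\<close> is singular, its shifts by almost all scalars move
  \<open>special_tensor\<close> within its orbit, and their images lie on a line through the image
  under \<open>g\<close>.\<close>

lemma invariant_special_orbit:
  assumes hom: "homogeneous d F" and inv: "SL_invariant (zero_locus {F})"
    and zero: "eval_poly F special_tensor = 0" and t: "hyperdet (($) t) = 0"
  shows "eval_poly F t = 0"
proof -
  note iff = GL_invariant_zero_iff[OF hom inv]
  obtain g h k where *: "det h \<noteq> 0" "det k \<noteq> 0" "act3 k (act2 h t) = act1 g special_tensor"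
    using special_orbit[OF t] by metis
  obtain q where q: "q \<noteq> 0" "\<And>s. poly q s = det (g + (\<chi> i j. if i = j then s else 0))"
    using singular_shifts by blast
  have "act1 (g + (\<chi> i j. if i = j then s else 0)) special_tensor =
      act1 g special_tensor + s *s special_tensor" for s
    by (rule tensor_eqI)
      (simp add: distrib_right sum.distrib if_distrib[of "\<lambda>x. x * _"] cong: if_cong)
  then have "eval_poly F (act1 g special_tensor + s *s special_tensor) = 0" if "poly q s \<noteq> 0" for s
    using iff(1)[of "g + (\<chi> i j. if i = j then s else 0)" special_tensor] zero that q(2) by simp
  from eval_poly_line_eq_0[OF q(1) this, of 0]
  have "eval_poly F (act1 g special_tensor) = 0" by simp
  then show ?thesis using iff(2,3) * by metis
qed

lemma eval_camera_poly_dir: "eval_poly camera_poly (\<chi> p. dir p) = 1"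
proof -
  have "($) (\<chi> p. dir p) = (dir :: tensor_index \<Rightarrow> complex)" by (simp add: fun_eq_iff)
  then show ?thesis by (simp only: eval_camera_poly hyperdet_dir)
qed

text \<open>The complement of the sextic is one orbit up to scalars, so one zero there makes
  \<open>F\<close> vanish on all of it. A line through \<open>dir\<close>, where the sextic is 1,
  leaves this complement only finitely often.\<close>

lemma invariant_generic_orbit:
  assumes hom: "homogeneous d F" and inv: "SL_invariant (zero_locus {F})"
    and t: "eval_poly F t = 0" "hyperdet (($) t) \<noteq> 0"
  shows "F = 0"
proof -
  note iff = GL_invariant_zero_iff[OF hom inv]
  have orbit: "eval_poly F u = 0 \<longleftrightarrow> eval_poly F generic_tensor = 0" if "hyperdet (($) u) \<noteq> 0" for u
    using generic_orbit[OF that] iff by metis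
  then have *: "eval_poly F u = 0" if "hyperdet (($) u) \<noteq> 0" for u using t that by blast
  have "eval_poly F u = 0" for u
  proof -
    let ?d = "(\<chi> p. dir p) :: tensor322"
    obtain q where q: "\<And>s. poly q s = eval_poly camera_poly (?d + s *s (u - ?d))"
      using eval_poly_line by blast
    have "poly q 0 = 1" using eval_camera_poly_dir by (simp add: q)
    then have "q \<noteq> 0" by auto
    then have "eval_poly F (?d + 1 *s (u - ?d)) = 0"
      by (rule eval_poly_line_eq_0) (simp add: q eval_camera_poly *)
    then show ?thesis by simp
  qed
  then show ?thesis by (intro cpoly_eqI) simp
qed

text \<open>Together with \<open>special_tensor\<close> it spans a pencil whose nonzero elements all have a flattening of
  rank 3.\<close>

definition pencil_tensor :: tensor322 where
  "pencil_tensor = (\<chi> p. if p \<in> {(1, 1, 1), (2, 1, 2), (3, 2, 1)} then 1 else 0)"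

text \<open>In the column order 11, 12, 21, 22 the rows of the flattening are (1, s, 0, 0), (0, 1,
  s, 0), (0, 0, 1, s), which is echelon form.\<close>

lemma rank_three_pencil: "rank_three (($) (pencil_tensor + s *s special_tensor))" "rank_three (($) special_tensor)"
  by (auto simp: rank_three_def pencil_tensor_def special_tensor_def forall_2 forall_3 sum_3 fun_eq_iff)

text \<open>A form of positive degree has a zero on the projective line spanned by the pencil. If it
  is constant on the affine chart, the zero is the point at infinity,
  \<open>special_tensor\<close>.\<close>

lemma zero_of_rank_three:
  assumes hom: "homogeneous d F" and "d > 0"
  obtains t where "rank_three (($) t)" "eval_poly F t = 0"
proof -
  obtain p where p: "\<And>s. poly p s = eval_poly F (pencil_tensor + s *s special_tensor)" using eval_poly_line by blast
  show thesis
  proof (cases "constant (poly p)")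
    case False
    then obtain s where "poly p s = 0" using fundamental_theorem_of_algebra by blast
    then show thesis using that rank_three_pencil(1) p by metis
  next
    case True
    obtain q where q: "\<And>s. poly q s = eval_poly F (special_tensor + s *s pencil_tensor)" using eval_poly_line by blast
    \<comment> \<open>In the opposite chart a constant restriction becomes a multiple of the
      \<open>d\<close>-th power of \<open>s\<close>, first for nonzero \<open>s\<close>.\<close>
    let ?r = "q - monom (poly p 0) d"
    have "poly ?r s = 0" if "s \<noteq> 0" for s
    proof -
      have "special_tensor + s *s pencil_tensor = s *s (pencil_tensor + (1 / s) *s special_tensor)"
        using that by (simp add: vec_eq_iff algebra_simps)
      then have "poly q s = s ^ d * poly p (1 / s)" by (simp only: q p eval_poly_homogeneous[OF hom])
      also have "poly p (1 / s) = poly p 0" using True by (auto simp: constant_def)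
      finally show ?thesis by (simp add: poly_monom mult.commute)
    qed
    \<comment> \<open>The extra factor \<open>s\<close> covers the excluded value 0.\<close>
    then have "poly (?r * [:0, 1:]) s = 0" for s by (cases "s = 0") auto
    then have "?r * [:0, 1:] = 0" using poly_all_0_iff_0 by blast
    then have "?r = 0" by simp
    then have "poly q 0 = poly (monom (poly p 0) d) 0" by simp
    then have "eval_poly F special_tensor = 0" using \<open>d > 0\<close> q[of 0] by (simp add: poly_monom)
    then show thesis using that rank_three_pencil(2) by blast
  qed
qed

lemma invariant_hypersurface_unique:
  assumes hom: "homogeneous d F" and "d > 0" "F \<noteq> 0" and inv: "SL_invariant (zero_locus {F})"
  shows "zero_locus {F} = camera_variety"
proof -
  note iff = GL_invariant_zero_iff[OF hom inv]
  have sub: "hyperdet (($) t) = 0" if "eval_poly F t = 0" for t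
    using invariant_generic_orbit[OF hom inv that] \<open>F \<noteq> 0\<close> by blast
  obtain t where t: "rank_three (($) t)" "eval_poly F t = 0"
    using zero_of_rank_three[OF hom \<open>d > 0\<close>] .
  obtain g h k where *: "det h \<noteq> 0" "det k \<noteq> 0" "act3 k (act2 h t) = act1 g special_tensor" "det g \<noteq> 0"
    using special_orbit[OF sub[OF t(2)]] t(1) by metis
  \<comment> \<open>All three matrices are invertible because \<open>t\<close> has a flattening of
    rank 3, so the zero moves to the representative.\<close>
  have "eval_poly F special_tensor = 0" using iff * t(2) by metis
  then have "eval_poly F t = 0 \<longleftrightarrow> hyperdet (($) t) = 0" for t
    using invariant_special_orbit[OF hom inv] sub by blast
  then show ?thesis
    unfolding camera_variety_eq zero_locus_eq[OF hom] zero_locus_eq[OF homogeneous_camera_poly]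
      eval_camera_poly by simp
qed

theorem proposition7p5:
  shows "{Y. hypersurface 6 Y \<and> SL_invariant Y} = {camera_variety} \<and>
         defining_form 6 camera_poly camera_variety"
proof -
  have nz: "camera_poly \<noteq> 0" using eval_camera_poly_dir by force
  then have "defining_form 6 camera_poly camera_variety"
    unfolding defining_form_def camera_variety_eq vanishing_ideal_camera
    using homogeneous_camera_poly by blast
  moreover have "hypersurface 6 camera_variety"
    unfolding hypersurface_def using nz homogeneous_camera_poly camera_variety_eq by blast
  moreover have "Y = camera_variety" if "hypersurface 6 Y" "SL_invariant Y" for Y
    using that invariant_hypersurface_unique[of 6] unfolding hypersurface_def by auto
  ultimately show ?thesis using SL_invariant_camera_variety by blast
qed

end
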